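(* Let $\mu_0,\mu_1$ be as in the context, and let the potentials be normalized such that $$\int f_\varepsilon\,d\mu_0=\int g_\varepsilon\,d\mu_1\quad\text{for all }\varepsilon>0,\qquad \int f_0\,d\mu_0=\int g_0\,d\mu_1.$$ There exist $C,\varepsilon_0>0$ such that for every $0<\varepsilon<\varepsilon_0$, $$\|f_\varepsilon-f_0\|_{C^{0,\frac12}(\Omega_0)}\le C\varepsilon^{\frac13}.$$
   Context: Standing assumption: for $i=0,1$, $\mu_i$ is a probability measure on $\mathbb{R}$ supported on a compact interval $\Omega_i=[a_i,b_i]$, with a continuous density $u_i\in\mathcal{C}(\Omega_i)$ (i.e. $d\mu_i=u_i\,dx$) satisfying $0<\lambda\le u_i\le\Lambda<\infty$ on $\Omega_i$ for constants $\lambda,\Lambda$. For $\varepsilon>0$, let $\pi_\varepsilon$ be the unique minimizer over couplings $\pi\in\Pi(\mu_0,\mu_1)$ of $\int\frac12(x-y)^2\,d\pi+\frac{\varepsilon}{2}\int\big(\frac{d\pi}{d(\mu_0\otimes\mu_1)}\big)^2d(\mu_0\otimes\mu_1)$. The potentials $(f_\varepsilon,g_\varepsilon)$ are continuous functions $f_\varepsilon:\Omega_0\to\mathbb{R}$, $g_\varepsilon:\Omega_1\to\mathbb{R}$ with $\frac{d\pi_\varepsilon}{d(\mu_0\otimes\mu_1)}(x,y)=\big(\frac{xy-f_\varepsilon(x)-g_\varepsilon(y)}{\varepsilon}\big)_+$, where $(a)_+=\max(a,0)$; equivalently they satisfy $\int(xy-f_\varepsilon(x)-g_\varepsilon(y))_+\,d\mu_1(y)=\varepsilon$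 for all $x\in\Omega_0$ and $\int(xy-f_\varepsilon(x)-g_\varepsilon(y))_+\,d\mu_0(x)=\varepsilon$ for all $y\in\Omega_1$. They exist and are unique up to replacing $(f_\varepsilon,g_\varepsilon)$ by $(f_\varepsilon+\alpha,g_\varepsilon-\alpha)$, $\alpha\in\mathbb{R}$. $(f_0,g_0)$ are the Kantorovich potentials of unregularized optimal transport: they minimize $\int f\,d\mu_0+\int g\,d\mu_1$ over pairs $(f,g)$ with $f(x)+g(y)\ge xy$, and are taken to be convex conjugates of one another, i.e. $f_0(x)=\sup_{y\in\Omega_1}(xy-g_0(y))$ on $\Omega_0$ and $g_0(y)=\sup_{x\in\Omega_0}(xy-f_0(x))$ on $\Omega_1$. They are unique up to replacing $(f_0,g_0)$ by $(f_0+\alpha,g_0-\alpha)$, and $f_0'=T_0$ is the optimal transport (Monge) map from $\mu_0$ to $\mu_1$. The Hölder norm is $\|h\|_{C^{0,\frac12}(\Omega_0)}:=\sup_{x\in\Omega_0}|h(x)|+\sup_{x,y\in\Omega_0,\,x\ne y}\frac{|h(x)-h(y)|}{|x-y|^{1/2}}$. *)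

theory Defs
  imports "HOL-Probability.Probability"
begin

text \<open>The values of \<open>u\<close> outside \<open>{a..b}\<close> play no role.\<close>

definition has_bounded_continuous_density ::
  "real \<Rightarrow> real \<Rightarrow> real \<Rightarrow> real \<Rightarrow> (real \<Rightarrow> real) \<Rightarrow> real measure \<Rightarrow> bool" where
  "has_bounded_continuous_density l L a b u \<mu> \<longleftrightarrow>
     prob_space \<mu> \<and>
     \<mu> = density lborel (\<lambda>x. ennreal (u x) * indicator {a..b} x) \<and>
     continuous_on {a..b} u \<and>
     0 < l \<and> (\<forall>x\<in>{a..b}. l \<le> u x \<and> u x \<le> L)"

definition couplings :: "real measure \<Rightarrow> real measure \<Rightarrow> (real \<times> real) measure set" where
  "couplings \<mu> \<nu> =
     {\<pi>. prob_space \<pi> \<and> sets \<pi> = sets borel \<and> distr \<pi> borel fst = \<mu> \<and> distr \<pi> borel snd = \<nu>}"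

text \<open>The objective is \<open>\<infinity>\<close> if \<open>\<pi>\<close> has no density with respect to the product measure.\<close>

definition qot_cost ::
  "real \<Rightarrow> real measure \<Rightarrow> real measure \<Rightarrow> (real \<times> real) measure \<Rightarrow> ennreal" where
  "qot_cost \<epsilon> \<mu> \<nu> \<pi> =
     (if absolutely_continuous (\<mu> \<Otimes>\<^sub>M \<nu>) \<pi>
      then (\<integral>\<^sup>+ z. ennreal ((fst z - snd z)\<^sup>2 / 2) \<partial>\<pi>)
         + ennreal (\<epsilon> / 2) * (\<integral>\<^sup>+ z. (RN_deriv (\<mu> \<Otimes>\<^sub>M \<nu>) \<pi> z)\<^sup>2 \<partial>(\<mu> \<Otimes>\<^sub>M \<nu>))
      else \<infinity>)"

definition is_qot_plan ::
  "real \<Rightarrow> real measure \<Rightarrow> real measure \<Rightarrow> (real \<times> real) measure \<Rightarrow> bool" where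
  "is_qot_plan \<epsilon> \<mu> \<nu> \<pi> \<longleftrightarrow>
     \<pi> \<in> couplings \<mu> \<nu> \<and> (\<forall>\<pi>'\<in>couplings \<mu> \<nu>. qot_cost \<epsilon> \<mu> \<nu> \<pi> \<le> qot_cost \<epsilon> \<mu> \<nu> \<pi>')"

text \<open>Potentials are functions on \<open>S\<close> and \<open>T\<close> (the supports of \<open>\<mu>\<close> and \<open>\<nu>\<close>), represented by total
  functions whose values elsewhere are arbitrary and possibly not measurable. Their integrals are
  therefore always set integrals over \<open>S\<close> and \<open>T\<close>. The optimal plan is unique, so the
  existential quantifier merely names it; a Radon--Nikodym derivative is determined only
  almost everywhere.\<close>

definition qot_potentials ::
  "real \<Rightarrow> real set \<Rightarrow> real set \<Rightarrow> real measure \<Rightarrow> real measure \<Rightarrow>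
   (real \<Rightarrow> real) \<Rightarrow> (real \<Rightarrow> real) \<Rightarrow> bool" where
  "qot_potentials \<epsilon> S T \<mu> \<nu> f g \<longleftrightarrow>
     continuous_on S f \<and> continuous_on T g \<and>
     (\<exists>\<pi>. is_qot_plan \<epsilon> \<mu> \<nu> \<pi> \<and>
          absolutely_continuous (\<mu> \<Otimes>\<^sub>M \<nu>) \<pi> \<and>
          (AE z in \<mu> \<Otimes>\<^sub>M \<nu>. RN_deriv (\<mu> \<Otimes>\<^sub>M \<nu>) \<pi> z =
             ennreal (max ((fst z * snd z - f (fst z) - g (snd z)) / \<epsilon>) 0)))"

definition dual_admissible ::
  "real set \<Rightarrow> real set \<Rightarrow> real measure \<Rightarrow> real measure \<Rightarrow>
   (real \<Rightarrow> real) \<Rightarrow> (real \<Rightarrow> real) \<Rightarrow> bool" where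
  "dual_admissible S T \<mu> \<nu> f g \<longleftrightarrow>
     set_integrable \<mu> S f \<and> set_integrable \<nu> T g \<and> (\<forall>x\<in>S. \<forall>y\<in>T. x * y \<le> f x + g y)"

text \<open>Admissibility makes the families under the two suprema bounded above.\<close>

definition kantorovich_potentials ::
  "real set \<Rightarrow> real set \<Rightarrow> real measure \<Rightarrow> real measure \<Rightarrow>
   (real \<Rightarrow> real) \<Rightarrow> (real \<Rightarrow> real) \<Rightarrow> bool" where
  "kantorovich_potentials S T \<mu> \<nu> f g \<longleftrightarrow>
     dual_admissible S T \<mu> \<nu> f g \<and>
     (\<forall>f' g'. dual_admissible S T \<mu> \<nu> f' g' \<longrightarrow>
        (LINT x:S|\<mu>. f x) + (LINT y:T|\<nu>. g y) \<le> (LINT x:S|\<mu>. f' x) + (LINT y:T|\<nu>. g' y)) \<and>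
     (\<forall>x\<in>S. f x = (SUP y\<in>T. x * y - g y)) \<and>
     (\<forall>y\<in>T. g y = (SUP x\<in>S. x * y - f x))"

text \<open>Valued in \<open>ennreal\<close> so that functions that are unbounded or not Hoelder have norm \<open>\<infinity>\<close>.\<close>

definition holder_norm :: "real \<Rightarrow> real set \<Rightarrow> (real \<Rightarrow> real) \<Rightarrow> ennreal" where
  "holder_norm \<alpha> S h =
     (SUP x\<in>S. ennreal \<bar>h x\<bar>)
     + (SUP (x, y)\<in>{(x, y). x \<in> S \<and> y \<in> S \<and> x \<noteq> y}.
          ennreal (\<bar>h x - h y\<bar> / \<bar>x - y\<bar> powr \<alpha>))"

end

theory Submission
  imports Defs
begin

text \<open>The estimate comes from comparing subgradients. Write \<open>T\<close> for the monotone transport map and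
  \<open>gap x y = f0 x + g0 y - x * y\<close>. By strong duality the gap vanishes exactly along the graph of \<open>T\<close>
  (\<open>kantorovich_contact\<close>), so that \<open>T\<close> is a subgradient of \<open>f0\<close>; and since \<open>T\<close> is bi-Lipschitz, the gap is
  comparable with \<open>(y - T x)\<^sup>2\<close> (\<open>gap_upper\<close>, \<open>gap_lower\<close>).

  Up to a constant, the regularized problem minimizes the excess, which is the integral of the gap plus
  \<open>\<epsilon> / 2\<close> times the squared norm of the density. Coupling \<open>N\<close> corresponding blocks of equal mass
  independently has excess of order \<open>1 / N\<^sup>2 + \<epsilon> N\<close>. With \<open>N\<close> of order \<open>\<epsilon> powr (- 1 / 3)\<close> this is
  \<open>\<epsilon> powr (2 / 3)\<close>, which therefore also bounds the excess of the optimal plan (\<open>excess_le\<close>), and hence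
  the mean over \<open>x\<close> of the second moment of its conditional distributions about \<open>T x\<close>
  (\<open>integral_deviation\<close>).

  The optimal density is the positive part of a function that is affine in the potentials. Its marginal
  conditions make both potentials convex, with a subgradient of \<open>f \<epsilon>\<close> at \<open>x\<close> given by the mean of \<open>y\<close> over
  the section \<open>{y. 0 < x * y - f \<epsilon> x - g \<epsilon> y}\<close> (\<open>potential_subgradient\<close>). The section is an interval, and
  the conditional density on it is concave up to a factor between \<open>l\<close> and \<open>L\<close>. So the squared distance
  of \<open>T x\<close> from this mean is at most a multiple of the second moment about \<open>T x\<close>
  (\<open>section_second_moment\<close>). Thus the subgradients of \<open>f \<epsilon>\<close> and \<open>f0\<close> differ by order \<open>\<epsilon> powr (1 / 3)\<close> in
  mean square, and integrating over \<open>{x..z}\<close> costs a factor \<open>sqrt (z - x)\<close> (\<open>potential_holder\<close>).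

  Finally, the sum of the means of the two potentials changes by at most twice the excess
  (\<open>potential_mean\<close>). The normalization splits it evenly, which fixes the additive constant.\<close>

section \<open>Measures that are comparable with Lebesgue measure on an interval\<close>

text \<open>A density between \<open>l\<close> and \<open>L\<close>, seen through the masses of intervals. The upper bound is required on
  the whole line, so that the distribution function is Lipschitz everywhere.\<close>

locale interval_measure = real_distribution \<mu> for \<mu> :: "real measure" +
  fixes a b l L :: real
  assumes l_pos: "0 < l"
    and AE_interval: "AE x in \<mu>. x \<in> {a..b}"
    and mass_lower: "\<And>x y. a \<le> x \<Longrightarrow> x \<le> y \<Longrightarrow> y \<le> b \<Longrightarrow> l * (y - x) \<le> measure \<mu> {x..y}"
    and mass_upper: "\<And>x y. x \<le> y \<Longrightarrow> measure \<mu> {x..y} \<le> L * (y - x)"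
begin

lemma mass_interval: "measure \<mu> {a..b} = 1"
  using AE_interval by (intro prob_eq_1[THEN iffD2]) auto

lemma a_less_b: "a < b"
proof (rule ccontr)
  assume "\<not> a < b"
  then have "measure \<mu> {a..b} = 0"
    using mass_upper[of a a] measure_nonneg[of \<mu> "{a}"]
    by (cases "a = b") (auto simp: order_antisym)
  then show False using mass_interval by simp
qed

lemma L_pos: "0 < L"
  using mass_upper[of a b] a_less_b mass_interval
  by (metis diff_gt_0_iff_gt less_eq_real_def less_le_trans zero_less_mult_pos2 zero_less_one)

lemma l_le_L: "l \<le> L"
  using mass_lower[of a b] mass_upper[of a b] a_less_b
  by (meson diff_gt_0_iff_gt dual_order.refl less_eq_real_def mult_le_cancel_right_pos order_trans)

lemma null_point: "measure \<mu> {x} = 0"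
  using mass_upper[of x x] measure_nonneg[of \<mu> "{x}"] by simp

lemma mass_half_open: "measure \<mu> {x<..y} = measure \<mu> {x..y}"
proof (cases "x \<le> y")
  case True
  have "{x..y} = {x} \<union> {x<..y}" using True by auto
  moreover have "measure \<mu> ({x} \<union> {x<..y}) = measure \<mu> {x} + measure \<mu> {x<..y}"
    by (rule finite_measure_Union) auto
  ultimately show ?thesis by (simp add: null_point)
qed auto

lemma cdf_diff: "x \<le> y \<Longrightarrow> cdf \<mu> y - cdf \<mu> x = measure \<mu> {x..y}"
  using cdf_diff_eq[of x y] by (cases "x = y") (auto simp: mass_half_open null_point)

lemma cdf_lipschitz: "x \<le> y \<Longrightarrow> cdf \<mu> y - cdf \<mu> x \<le> L * (y - x)"
  by (simp add: cdf_diff mass_upper)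

lemma cdf_expansion: "a \<le> x \<Longrightarrow> x \<le> y \<Longrightarrow> y \<le> b \<Longrightarrow> l * (y - x) \<le> cdf \<mu> y - cdf \<mu> x"
  by (simp add: cdf_diff mass_lower)

lemma cdf_dist_le: "\<bar>cdf \<mu> x - cdf \<mu> y\<bar> \<le> L * \<bar>x - y\<bar>"
  using cdf_lipschitz[of x y] cdf_lipschitz[of y x] cdf_nondecreasing[of x y]
    cdf_nondecreasing[of y x] by (cases "x \<le> y") auto

lemma cdf_dist_ge:
  "x \<in> {a..b} \<Longrightarrow> y \<in> {a..b} \<Longrightarrow> l * \<bar>x - y\<bar> \<le> \<bar>cdf \<mu> x - cdf \<mu> y\<bar>"
  using cdf_expansion[of x y] cdf_expansion[of y x] cdf_nondecreasing[of x y]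
    cdf_nondecreasing[of y x] by (cases "x \<le> y") auto

lemma continuous_cdf: "continuous_on S (cdf \<mu>)"
proof -
  have "L-lipschitz_on UNIV (cdf \<mu>)"
    using cdf_dist_le L_pos by (intro lipschitz_onI) (auto simp: dist_real_def)
  then show ?thesis using lipschitz_on_continuous_on continuous_on_subset by blast
qed

lemma cdf_b: "cdf \<mu> b = 1"
proof -
  have "measure \<mu> {..b} = 1"
    using AE_interval by (intro prob_eq_1[THEN iffD2]) auto
  then show ?thesis by (simp add: cdf_def)
qed

lemma cdf_a: "cdf \<mu> a = 0"
  using cdf_diff[of a b] a_less_b by (simp add: cdf_b mass_interval)

lemma cdf_eq_iff: "x \<in> {a..b} \<Longrightarrow> y \<in> {a..b} \<Longrightarrow> cdf \<mu> x = cdf \<mu> y \<longleftrightarrow> x = y"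
  using cdf_dist_ge[of x y] l_pos by (auto simp: mult_le_0_iff)

lemma cdf_le_iff: "x \<in> {a..b} \<Longrightarrow> y \<in> {a..b} \<Longrightarrow> cdf \<mu> x \<le> cdf \<mu> y \<longleftrightarrow> x \<le> y"
  using cdf_nondecreasing[of x y] cdf_nondecreasing[of y x] cdf_eq_iff[of x y] by force

definition quantile :: "real \<Rightarrow> real" where
  "quantile t = (SOME x. x \<in> {a..b} \<and> cdf \<mu> x = t)"

lemma
  assumes "t \<in> {0..1}"
  shows quantile_mem: "quantile t \<in> {a..b}" and cdf_quantile: "cdf \<mu> (quantile t) = t"
proof -
  have "\<exists>x. a \<le> x \<and> x \<le> b \<and> cdf \<mu> x = t"
    using assms a_less_b cdf_a cdf_b by (intro IVT' continuous_cdf) auto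
  then have "\<exists>x. x \<in> {a..b} \<and> cdf \<mu> x = t" by auto
  then have "quantile t \<in> {a..b} \<and> cdf \<mu> (quantile t) = t"
    unfolding quantile_def by (rule someI_ex)
  then show "quantile t \<in> {a..b}" "cdf \<mu> (quantile t) = t" by auto
qed

lemma quantile_cdf: "x \<in> {a..b} \<Longrightarrow> quantile (cdf \<mu> x) = x"
  using quantile_mem[of "cdf \<mu> x"] cdf_quantile[of "cdf \<mu> x"] cdf_nonneg[of x]
    cdf_bounded_prob[of x] by (subst cdf_eq_iff[symmetric]) auto

lemma cdf_mem: "cdf \<mu> x \<in> {0..1}"
  using cdf_nonneg[of x] cdf_bounded_prob[of x] by auto

lemma quantile_dist_le:
  assumes "s \<in> {0..1}" "t \<in> {0..1}"
  shows "l * \<bar>quantile s - quantile t\<bar> \<le> \<bar>s - t\<bar>"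
  using cdf_dist_ge[OF quantile_mem[OF assms(1)] quantile_mem[OF assms(2)]] assms
  by (simp add: cdf_quantile)

lemma quantile_dist_ge:
  assumes "s \<in> {0..1}" "t \<in> {0..1}"
  shows "\<bar>s - t\<bar> \<le> L * \<bar>quantile s - quantile t\<bar>"
  using cdf_dist_le[of "quantile s" "quantile t"] assms by (simp add: cdf_quantile)

lemma quantile_mono: "s \<in> {0..1} \<Longrightarrow> t \<in> {0..1} \<Longrightarrow> s \<le> t \<Longrightarrow> quantile s \<le> quantile t"
  using cdf_le_iff[OF quantile_mem[of s] quantile_mem[of t]] by (simp add: cdf_quantile)

lemma mass_cdf_le:
  assumes "t \<in> {0..1}"
  shows "measure \<mu> {x. cdf \<mu> x \<le> t} = t"
proof -
  have "measure \<mu> {x. cdf \<mu> x \<le> t} = measure \<mu> {..quantile t}"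
  proof (rule measure_eq_AE)
    show "AE x in \<mu>. (x \<in> {x. cdf \<mu> x \<le> t}) = (x \<in> {..quantile t})"
      using AE_interval
    proof eventually_elim
      case (elim x)
      then show ?case
        using cdf_le_iff[OF elim quantile_mem[OF assms]] cdf_quantile[OF assms] by auto
    qed
    show "{x. cdf \<mu> x \<le> t} \<in> sets \<mu>"
      using borel_measurable_continuous_onI[OF continuous_cdf[of UNIV]] by simp
  qed auto
  also have "\<dots> = t" using cdf_quantile[OF assms] by (simp add: cdf_def)
  finally show ?thesis .
qed

subsection \<open>Integrals of continuous functions\<close>

lemma integrable_continuous:
  fixes h :: "real \<Rightarrow> real"
  assumes "continuous_on UNIV h"
  shows "integrable \<mu> h"
proof -
  have "bounded (h ` {a..b})"
    using assms by (intro compact_imp_bounded compact_continuous_image)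
      (auto intro: continuous_on_subset)
  then obtain B where B: "\<And>x. x \<in> {a..b} \<Longrightarrow> norm (h x) \<le> B"
    unfolding bounded_iff by blast
  show ?thesis
  proof (rule integrable_const_bound[of _ B])
    show "AE x in \<mu>. norm (h x) \<le> B" using AE_interval by eventually_elim (rule B)
  qed (use borel_measurable_continuous_onI[OF assms] in simp)
qed

text \<open>The measure charges every subinterval, so a continuous function that vanishes almost everywhere
  vanishes on all of the support.\<close>

lemma AE_zero_imp_zero:
  fixes h :: "real \<Rightarrow> real"
  assumes cont: "continuous_on UNIV h" and ae: "AE x in \<mu>. h x = 0" and x: "x \<in> {a..b}"
  shows "h x = 0"
proof (rule ccontr)
  assume "h x \<noteq> 0"
  then have "open (h -` (- {0}))" "x \<in> h -` (- {0})"
    using cont by (auto intro: open_vimage)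
  then obtain d where d: "0 < d" "\<And>y. \<bar>y - x\<bar> < d \<Longrightarrow> h y \<noteq> 0"
    unfolding open_dist dist_real_def by auto
  define u where "u = max a (x - d / 2)"
  define v where "v = min b (x + d / 2)"
  have uv: "a \<le> u" "u < v" "v \<le> b" using d(1) x a_less_b by (auto simp: u_def v_def)
  have sub: "h y \<noteq> 0" if "y \<in> {u..v}" for y
    using that d by (intro d(2)) (auto simp: u_def v_def)
  have "AE y in \<mu>. y \<notin> {u..v}"
    using ae by eventually_elim (use sub in blast)
  then have "measure \<mu> {u..v} = 0"
    by (subst prob_eq_0) auto
  moreover have "0 < l * (v - u)" using uv l_pos by simp
  ultimately show False using mass_lower[of u v] uv by simp
qed

lemma set_integral_continuous:
  fixes h :: "real \<Rightarrow> real"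
  assumes "continuous_on UNIV h"
  shows "(LINT x:{a..b}|\<mu>. h x) = (LINT x|\<mu>. h x)"
  unfolding set_lebesgue_integral_def
  by (rule integral_cong_AE)
    (use AE_interval borel_measurable_continuous_onI[OF assms] in \<open>auto simp: indicator_def\<close>)

lemma set_integral_interval:
  fixes h :: "real \<Rightarrow> real"
  assumes "continuous_on UNIV (\<lambda>x. h (max a (min b x)))"
  shows "(LINT x:{a..b}|\<mu>. h x) = (LINT x|\<mu>. h (max a (min b x)))"
proof -
  have "(LINT x:{a..b}|\<mu>. h x) = (LINT x:{a..b}|\<mu>. h (max a (min b x)))"
    unfolding set_lebesgue_integral_def
    by (intro Bochner_Integration.integral_cong) (auto simp: indicator_def max_def min_def)
  also have "\<dots> = (LINT x|\<mu>. h (max a (min b x)))"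
    by (rule set_integral_continuous[OF assms])
  finally show ?thesis .
qed

lemma set_integrable_continuous:
  fixes h :: "real \<Rightarrow> real"
  assumes "continuous_on UNIV h"
  shows "set_integrable \<mu> {a..b} h"
  unfolding set_integrable_def
  by (intro integrable_mult_indicator integrable_continuous[OF assms]) simp

end

lemma continuous_on_clamp:
  fixes h :: "real \<Rightarrow> real"
  assumes "continuous_on {a..b} h" "a \<le> b"
  shows "continuous_on UNIV (\<lambda>x. h (max a (min b x)))"
  by (rule continuous_on_compose2[OF assms(1)]) (use assms(2) in \<open>auto intro!: continuous_intros\<close>)

lemma has_bounded_continuous_density_imp_interval_measure:
  assumes "has_bounded_continuous_density l L a b u \<mu>"
  shows "interval_measure \<mu> a b l L"
proof -
  have "prob_space \<mu>" and \<mu>: "\<mu> = density lborel (\<lambda>x. ennreal (u x) * indicator {a..b} x)"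
    and cont: "continuous_on {a..b} u" and "0 < l"
    and bnd: "\<And>x. x \<in> {a..b} \<Longrightarrow> l \<le> u x \<and> u x \<le> L"
    using assms by (auto simp: has_bounded_continuous_density_def)
  interpret prob_space \<mu> by fact
  have sets_\<mu>: "sets \<mu> = sets borel" unfolding \<mu> by simp
  interpret real_distribution \<mu> by standard (simp_all add: sets_\<mu>)
  have meas[measurable]: "(\<lambda>x. ennreal (u x) * indicator {a..b} x) \<in> borel_measurable borel"
  proof -
    have "(\<lambda>x. ennreal (indicator {a..b} x *\<^sub>R u x)) \<in> borel_measurable borel"
      using borel_measurable_continuous_on_indicator[OF _ cont] by simp
    also have "(\<lambda>x. ennreal (indicator {a..b} x *\<^sub>R u x)) = (\<lambda>x. ennreal (u x) * indicator {a..b} x)"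
      by (rule ext) (simp split: split_indicator)
    finally show ?thesis .
  qed
  have em: "emeasure \<mu> A = (\<integral>\<^sup>+x. ennreal (u x) * indicator {a..b} x * indicator A x \<partial>lborel)"
    if "A \<in> sets borel" for A
    unfolding \<mu> by (rule emeasure_density) (use that in auto)
  have "l \<le> L" if "a \<le> b" using bnd[of a] that by auto
  have "a \<le> b"
  proof (rule ccontr)
    assume "\<not> a \<le> b"
    then have "emeasure \<mu> UNIV = 0" by (subst em) auto
    then show False using emeasure_space_1 by (simp add: space_eq_univ)
  qed
  have "0 \<le> L" using \<open>0 < l\<close> \<open>a \<le> b \<Longrightarrow> l \<le> L\<close> \<open>a \<le> b\<close> by simp
  show ?thesis
  proof
    show "0 < l" by fact
    show "AE x in \<mu>. x \<in> {a..b}"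
      unfolding \<mu> by (subst AE_density[OF meas[folded measurable_lborel2]]) (auto split: split_indicator)
    show "l * (y - x) \<le> measure \<mu> {x..y}" if "a \<le> x" "x \<le> y" "y \<le> b" for x y
    proof -
      have "ennreal (l * (y - x)) = (\<integral>\<^sup>+z. ennreal l * indicator {x..y} z \<partial>lborel)"
        using that \<open>0 < l\<close> by (simp add: nn_integral_cmult ennreal_mult')
      also have "\<dots> \<le> emeasure \<mu> {x..y}"
        using that bnd by (subst em) (auto intro!: nn_integral_mono simp: indicator_def ennreal_leI)
      finally show ?thesis by (simp add: emeasure_eq_measure)
    qed
    show "measure \<mu> {x..y} \<le> L * (y - x)" if "x \<le> y" for x y
    proof -
      have "emeasure \<mu> {x..y} \<le> (\<integral>\<^sup>+z. ennreal L * indicator {x..y} z \<partial>lborel)"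
        using that bnd by (subst em) (auto intro!: nn_integral_mono simp: indicator_def ennreal_leI)
      also have "\<dots> = ennreal (L * (y - x))"
        using that \<open>0 \<le> L\<close> by (simp add: nn_integral_cmult ennreal_mult')
      finally show ?thesis using that \<open>0 \<le> L\<close> by (simp add: emeasure_eq_measure)
    qed
  qed
qed

section \<open>The monotone transport map and the Kantorovich potentials\<close>

locale interval_pair =
  X: interval_measure \<mu>0 a0 b0 l L + Y: interval_measure \<mu>1 a1 b1 l L
  for \<mu>0 \<mu>1 :: "real measure" and a0 b0 a1 b1 l L :: real
begin

sublocale P: pair_prob_space \<mu>0 \<mu>1 ..

text \<open>\<open>T\<close> is the monotone rearrangement of \<open>\<mu>0\<close> into \<open>\<mu>1\<close>, extended by constants, and \<open>S\<close> is its inverse.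
  Comparing masses of intervals shows that both are Lipschitz, without differentiating them.\<close>

definition T :: "real \<Rightarrow> real" where "T x = Y.quantile (cdf \<mu>0 x)"
definition S :: "real \<Rightarrow> real" where "S y = X.quantile (cdf \<mu>1 y)"

lemma T_mem: "T x \<in> {a1..b1}" and cdf_T: "cdf \<mu>1 (T x) = cdf \<mu>0 x"
  unfolding T_def by (rule Y.quantile_mem[OF X.cdf_mem], rule Y.cdf_quantile[OF X.cdf_mem])

lemma S_mem: "S y \<in> {a0..b0}" and cdf_S: "cdf \<mu>0 (S y) = cdf \<mu>1 y"
  unfolding S_def by (rule X.quantile_mem[OF Y.cdf_mem], rule X.cdf_quantile[OF Y.cdf_mem])

lemma T_S: "y \<in> {a1..b1} \<Longrightarrow> T (S y) = y"
  by (simp add: T_def cdf_S Y.quantile_cdf)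

lemma S_T: "x \<in> {a0..b0} \<Longrightarrow> S (T x) = x"
  by (simp add: S_def cdf_T X.quantile_cdf)

lemma T_mono: "x \<le> z \<Longrightarrow> T x \<le> T z"
  unfolding T_def by (intro Y.quantile_mono X.cdf_mem X.cdf_nondecreasing)

lemma T_lipschitz: "l * \<bar>T x - T z\<bar> \<le> L * \<bar>x - z\<bar>"
  using Y.quantile_dist_le[OF X.cdf_mem X.cdf_mem, of x z] X.cdf_dist_le[of x z]
  by (simp add: T_def)

lemma S_lipschitz: "l * \<bar>S x - S z\<bar> \<le> L * \<bar>x - z\<bar>"
  using X.quantile_dist_le[OF Y.cdf_mem Y.cdf_mem, of x z] Y.cdf_dist_le[of x z]
  by (simp add: S_def)

lemma T_expansion:
  assumes "x \<in> {a0..b0}" "z \<in> {a0..b0}"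
  shows "l * \<bar>x - z\<bar> \<le> L * \<bar>T x - T z\<bar>"
  using X.cdf_dist_ge[OF assms] Y.quantile_dist_ge[OF X.cdf_mem X.cdf_mem, of x z]
  by (simp add: T_def)

lemma continuous_T: "continuous_on A T"
proof -
  have "(L / l)-lipschitz_on UNIV T"
    using T_lipschitz X.L_pos X.l_pos
    by (intro lipschitz_onI) (simp_all add: dist_real_def pos_le_divide_eq mult.commute)
  then show ?thesis using lipschitz_on_continuous_on continuous_on_subset by blast
qed

lemma continuous_S: "continuous_on A S"
proof -
  have "(L / l)-lipschitz_on UNIV S"
    using S_lipschitz X.L_pos X.l_pos
    by (intro lipschitz_onI) (simp_all add: dist_real_def pos_le_divide_eq mult.commute)
  then show ?thesis using lipschitz_on_continuous_on continuous_on_subset by blast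
qed

lemma measurable_T [measurable]: "T \<in> borel_measurable borel"
  by (rule borel_measurable_continuous_onI[OF continuous_T])

lemma distr_T: "distr \<mu>0 borel T = \<mu>1"
proof (rule cdf_unique)
  show "real_distribution (distr \<mu>0 borel T)"
    by (intro X.real_distribution_distr) simp
  show "real_distribution \<mu>1" by (rule Y.real_distribution_axioms)
  show "cdf (distr \<mu>0 borel T) = cdf \<mu>1"
  proof
    fix y
    have *: "cdf (distr \<mu>0 borel T) y = measure \<mu>0 {x. T x \<le> y}"
      unfolding cdf_def by (subst measure_distr) (simp_all add: vimage_def)
    consider "y < a1" | "y \<in> {a1..b1}" | "b1 < y" by (meson atLeastAtMost_iff not_le)
    then show "cdf (distr \<mu>0 borel T) y = cdf \<mu>1 y"
    proof cases
      case 1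
      then have "\<not> T x \<le> y" for x using T_mem[of x] by auto
      then have "{x. T x \<le> y} = {}" by auto
      moreover have "cdf \<mu>1 y = 0"
        using Y.cdf_nondecreasing[of y a1] Y.cdf_nonneg[of y] 1 Y.cdf_a by simp
      ultimately show ?thesis using * by simp
    next
      case 2
      have "T x \<le> y \<longleftrightarrow> cdf \<mu>0 x \<le> cdf \<mu>1 y" for x
        using Y.cdf_le_iff[OF T_mem[of x] 2] by (simp add: cdf_T)
      then show ?thesis using * X.mass_cdf_le[OF Y.cdf_mem] by simp
    next
      case 3
      then have "T x \<le> y" for x using T_mem[of x] by auto
      then have "{x. T x \<le> y} = UNIV" by auto
      moreover have "cdf \<mu>1 y = 1"
        using Y.cdf_nondecreasing[of b1 y] Y.cdf_bounded_prob[of y] 3 Y.cdf_b by simp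
      ultimately show ?thesis using * X.prob_space by simp
    qed
  qed
qed

lemma integral_T:
  fixes h :: "real \<Rightarrow> real"
  assumes "continuous_on UNIV h"
  shows "(LINT y|\<mu>1. h y) = (LINT x|\<mu>0. h (T x))"
proof -
  have "(LINT y|distr \<mu>0 borel T. h y) = (LINT x|\<mu>0. h (T x))"
    by (rule integral_distr) (use borel_measurable_continuous_onI[OF assms] in auto)
  then show ?thesis by (simp only: distr_T)
qed

text \<open>Strong duality, by exhibiting a dual pair without gap: an antiderivative \<open>F\<close> of the monotone
  map \<open>T\<close> is convex, and its conjugate touches the constraint exactly along the graph of \<open>T\<close>.\<close>

lemma dual_pair_of_transport_map:
  obtains F G where "continuous_on UNIV F" "continuous_on UNIV G"
    "\<And>x y. x \<in> {a0..b0} \<Longrightarrow> y \<in> {a1..b1} \<Longrightarrow> x * y \<le> F x + G y"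
    "\<And>x. x \<in> {a0..b0} \<Longrightarrow> F x + G (T x) = x * T x"
proof -
  obtain F where F: "\<And>x. x \<in> {a0..b0} \<Longrightarrow> (F has_vector_derivative T x) (at x within {a0..b0})"
    using antiderivative_continuous[OF continuous_T] by blast
  have subgrad: "F z + T z * (x - z) \<le> F x" if x: "x \<in> {a0..b0}" and z: "z \<in> {a0..b0}" for x z
  proof -
    have mvt: "\<exists>\<xi>\<in>{u..v}. F v - F u = T \<xi> * (v - u)" if "u \<le> v" "{u..v} \<subseteq> {a0..b0}" for u v
    proof -
      have "\<exists>\<xi>\<in>{u..v}. F v - F u = (v - u) *\<^sub>R T \<xi>"
      proof (rule mvt_very_simple[OF that(1)])
        fix \<xi> assume "u \<le> \<xi>" "\<xi> \<le> v"
        then have "(F has_vector_derivative T \<xi>) (at \<xi> within {u..v})"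
          using that by (intro has_vector_derivative_within_subset[OF F]) auto
        then show "(F has_derivative (\<lambda>h. h *\<^sub>R T \<xi>)) (at \<xi> within {u..v})"
          by (simp add: has_vector_derivative_def)
      qed
      then show ?thesis by (simp add: mult.commute)
    qed
    show ?thesis
    proof (cases "z \<le> x")
      case True
      obtain \<xi> where "\<xi> \<in> {z..x}" "F x - F z = T \<xi> * (x - z)"
        using mvt[OF True] x z by auto
      moreover have "T z * (x - z) \<le> T \<xi> * (x - z)"
        using True \<open>\<xi> \<in> {z..x}\<close> by (intro mult_right_mono T_mono) auto
      ultimately show ?thesis by linarith
    next
      case False
      obtain \<xi> where "\<xi> \<in> {x..z}" "F z - F x = T \<xi> * (z - x)"
        using mvt[of x z] False x z by auto
      moreover have "T \<xi> * (z - x) \<le> T z * (z - x)"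
        using False \<open>\<xi> \<in> {x..z}\<close> by (intro mult_right_mono T_mono) auto
      ultimately show ?thesis by (simp add: algebra_simps)
    qed
  qed
  define F' where "F' x = F (max a0 (min b0 x))" for x
  define G where "G y = y * S y - F' (S y)" for y
  have F'_eq: "F' x = F x" if "x \<in> {a0..b0}" for x using that by (simp add: F'_def)
  have "continuous_on {a0..b0} F"
    unfolding continuous_on_eq_continuous_within
    by (intro ballI has_vector_derivative_continuous[OF F])
  then have F'_cont: "continuous_on UNIV F'"
    unfolding F'_def by (intro continuous_on_clamp) (use X.a_less_b in auto)
  show ?thesis
  proof
    show "continuous_on UNIV F'" by fact
    show "continuous_on UNIV G"
      unfolding G_def by (intro continuous_intros continuous_S continuous_on_compose2[OF F'_cont]) auto
    show "x * y \<le> F' x + G y" if "x \<in> {a0..b0}" "y \<in> {a1..b1}" for x y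
      using subgrad[OF that(1) S_mem, of y] that S_mem[of y]
      by (simp add: G_def F'_eq T_S algebra_simps)
    show "F' x + G (T x) = x * T x" if "x \<in> {a0..b0}" for x
      using that by (simp add: G_def S_T)
  qed
qed

end

text \<open>The affine functions have slopes in the bounded interval \<open>{c..d}\<close>, so their supremum is Lipschitz.\<close>

lemma continuous_on_conjugate:
  fixes f g :: "real \<Rightarrow> real"
  assumes "c \<le> d"
    and conj: "\<And>x. x \<in> A \<Longrightarrow> f x = (SUP y\<in>{c..d}. x * y - g y)"
    and adm: "\<And>x y. x \<in> A \<Longrightarrow> y \<in> {c..d} \<Longrightarrow> x * y \<le> f x + g y"
  shows "continuous_on A f"
proof -
  define K where "K = \<bar>c\<bar> + \<bar>d\<bar>"
  have le: "f x \<le> f z + K * \<bar>x - z\<bar>" if "x \<in> A" "z \<in> A" for x z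
    unfolding conj[OF that(1)]
  proof (rule cSUP_least)
    show "{c..d} \<noteq> {}" using assms(1) by simp
    fix y assume y: "y \<in> {c..d}"
    have "(x - z) * y \<le> \<bar>x - z\<bar> * \<bar>y\<bar>" by (metis abs_ge_self abs_mult)
    also have "\<dots> \<le> \<bar>x - z\<bar> * K" using y by (intro mult_left_mono) (auto simp: K_def)
    finally show "x * y - g y \<le> f z + K * \<bar>x - z\<bar>"
      using adm[OF that(2) y] by (simp add: algebra_simps)
  qed
  have "K-lipschitz_on A f"
  proof (rule lipschitz_onI)
    fix x z assume "x \<in> A" "z \<in> A"
    then show "dist (f x) (f z) \<le> K * dist x z"
      using le[of x z] le[of z x] by (simp add: dist_real_def abs_le_iff abs_minus_commute)
  qed (simp add: K_def)
  then show ?thesis by (rule lipschitz_on_continuous_on)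
qed

context interval_pair
begin

lemma kantorovich_continuous:
  assumes k: "kantorovich_potentials {a0..b0} {a1..b1} \<mu>0 \<mu>1 f0 g0"
  shows "continuous_on {a0..b0} f0" "continuous_on {a1..b1} g0"
proof -
  have "dual_admissible {a0..b0} {a1..b1} \<mu>0 \<mu>1 f0 g0"
    and f0: "\<And>x. x \<in> {a0..b0} \<Longrightarrow> f0 x = (SUP y\<in>{a1..b1}. x * y - g0 y)"
    and g0: "\<And>y. y \<in> {a1..b1} \<Longrightarrow> g0 y = (SUP x\<in>{a0..b0}. x * y - f0 x)"
    using k unfolding kantorovich_potentials_def by (blast, blast, blast)
  then have adm: "\<And>x y. x \<in> {a0..b0} \<Longrightarrow> y \<in> {a1..b1} \<Longrightarrow> x * y \<le> f0 x + g0 y"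
    unfolding dual_admissible_def by blast
  show "continuous_on {a0..b0} f0"
    by (rule continuous_on_conjugate[OF _ f0 adm]) (use Y.a_less_b in auto)
  show "continuous_on {a1..b1} g0"
  proof (rule continuous_on_conjugate[of a0 b0])
    show "g0 y = (SUP x\<in>{a0..b0}. y * x - f0 x)" if "y \<in> {a1..b1}" for y
      using g0[OF that] by (simp add: mult.commute)
    show "y * x \<le> g0 y + f0 x" if "y \<in> {a1..b1}" "x \<in> {a0..b0}" for x y
      using adm[OF that(2,1)] by (simp add: algebra_simps)
  qed (use X.a_less_b in simp)
qed

text \<open>Tested against the dual pair built from \<open>T\<close>, optimality forces the gap \<open>f0 x + g0 y - x * y\<close> to have
  integral at most zero along the graph of \<open>T\<close>. It is nonnegative and continuous there, so it
  vanishes.\<close>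

lemma kantorovich_contact:
  assumes k: "kantorovich_potentials {a0..b0} {a1..b1} \<mu>0 \<mu>1 f0 g0" and x: "x \<in> {a0..b0}"
  shows "f0 x + g0 (T x) = x * T x"
proof -
  have "dual_admissible {a0..b0} {a1..b1} \<mu>0 \<mu>1 f0 g0"
    and opt: "\<And>f' g'. dual_admissible {a0..b0} {a1..b1} \<mu>0 \<mu>1 f' g' \<Longrightarrow>
        (LINT x:{a0..b0}|\<mu>0. f0 x) + (LINT y:{a1..b1}|\<mu>1. g0 y)
        \<le> (LINT x:{a0..b0}|\<mu>0. f' x) + (LINT y:{a1..b1}|\<mu>1. g' y)"
    using k unfolding kantorovich_potentials_def by (blast, blast)
  then have adm: "\<And>x y. x \<in> {a0..b0} \<Longrightarrow> y \<in> {a1..b1} \<Longrightarrow> x * y \<le> f0 x + g0 y"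
    unfolding dual_admissible_def by blast
  define f' where "f' x = f0 (max a0 (min b0 x))" for x
  define g' where "g' y = g0 (max a1 (min b1 y))" for y
  have cf: "continuous_on UNIV f'"
    unfolding f'_def by (rule continuous_on_clamp[OF kantorovich_continuous(1)[OF k]])
      (use X.a_less_b in simp)
  have cg: "continuous_on UNIV g'"
    unfolding g'_def by (rule continuous_on_clamp[OF kantorovich_continuous(2)[OF k]])
      (use Y.a_less_b in simp)
  obtain F G where FG: "continuous_on UNIV F" "continuous_on UNIV G"
    "\<And>x y. x \<in> {a0..b0} \<Longrightarrow> y \<in> {a1..b1} \<Longrightarrow> x * y \<le> F x + G y"
    "\<And>x. x \<in> {a0..b0} \<Longrightarrow> F x + G (T x) = x * T x"
    using dual_pair_of_transport_map by blast
  have cont_T: "continuous_on UNIV (\<lambda>x. h (T x))" if "continuous_on UNIV h" for h :: "real \<Rightarrow> real"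
    by (rule continuous_on_compose2[OF that continuous_T]) auto
  note int = X.integrable_continuous[OF cf] X.integrable_continuous[OF cont_T[OF cg]]
    X.integrable_continuous[OF FG(1)] X.integrable_continuous[OF cont_T[OF FG(2)]]
  have "(LINT x|\<mu>0. f' x) + (LINT y|\<mu>1. g' y) \<le> (LINT x|\<mu>0. F x) + (LINT y|\<mu>1. G y)"
    using opt[of F G] FG(3) X.set_integrable_continuous[OF FG(1)] Y.set_integrable_continuous[OF FG(2)]
    by (simp add: dual_admissible_def X.set_integral_continuous[OF FG(1)] 
        Y.set_integral_continuous[OF FG(2)]
        X.set_integral_interval[OF cf[unfolded f'_def], folded f'_def]
        Y.set_integral_interval[OF cg[unfolded g'_def], folded g'_def])
  then have "(LINT x|\<mu>0. f' x + g' (T x)) \<le> (LINT x|\<mu>0. F x + G (T x))"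
    using int by (simp add: integral_T[OF cg] integral_T[OF FG(2)])
  also have "\<dots> = (LINT x|\<mu>0. x * T x)"
  proof (rule integral_cong_AE)
    show "AE x in \<mu>0. F x + G (T x) = x * T x"
      using X.AE_interval by eventually_elim (rule FG(4))
  qed (use borel_measurable_integrable[OF int(3)] borel_measurable_integrable[OF int(4)] in auto)
  finally have le: "(LINT x|\<mu>0. f' x + g' (T x)) \<le> (LINT x|\<mu>0. x * T x)" .
  define h where "h x = f' x + g' (T x) - x * T x" for x
  have ch: "continuous_on UNIV h"
    unfolding h_def by (intro continuous_intros cf cont_T[OF cg] continuous_T)
  have "continuous_on UNIV (\<lambda>x. x * T x)" by (intro continuous_intros continuous_T)
  then have "(LINT x|\<mu>0. h x) \<le> 0"
    unfolding h_def using le int X.integrable_continuous by simp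
  moreover have h_nonneg: "AE x in \<mu>0. 0 \<le> h x"
    using X.AE_interval
  proof eventually_elim
    case (elim x)
    then show ?case using adm[OF elim T_mem] T_mem[of x] by (simp add: h_def f'_def g'_def)
  qed
  ultimately have "(LINT x|\<mu>0. h x) = 0"
    using integral_nonneg_AE[OF h_nonneg] by simp
  then have "AE x in \<mu>0. h x = 0"
    using integral_nonneg_eq_0_iff_AE[OF X.integrable_continuous[OF ch] h_nonneg] by simp
  then have "h x = 0" by (rule X.AE_zero_imp_zero[OF ch _ x])
  then show ?thesis using x T_mem[of x] by (simp add: h_def f'_def g'_def)
qed

end

section \<open>Quadratic growth of the duality gap\<close>

locale contact_pair = interval_pair +
  fixes f0 g0 :: "real \<Rightarrow> real"
  assumes continuous_f0: "continuous_on UNIV f0" and continuous_g0: "continuous_on UNIV g0"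
    and admissible: "\<And>x y. x \<in> {a0..b0} \<Longrightarrow> y \<in> {a1..b1} \<Longrightarrow> x * y \<le> f0 x + g0 y"
    and contact: "\<And>x. x \<in> {a0..b0} \<Longrightarrow> f0 x + g0 (T x) = x * T x"
begin

definition gap :: "real \<Rightarrow> real \<Rightarrow> real" where "gap x y = f0 x + g0 y - x * y"

lemma gap_nonneg: "x \<in> {a0..b0} \<Longrightarrow> y \<in> {a1..b1} \<Longrightarrow> 0 \<le> gap x y"
  using admissible[of x y] by (simp add: gap_def)

lemma f0_subgradient:
  assumes "x \<in> {a0..b0}" "z \<in> {a0..b0}"
  shows "f0 z + T z * (x - z) \<le> f0 x"
  using admissible[OF assms(1) T_mem[of z]] contact[OF assms(2)] by (simp add: algebra_simps)

lemma gap_eq: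
  assumes "y \<in> {a1..b1}"
  shows "gap x y = f0 x - f0 (S y) - y * (x - S y)"
  using contact[OF S_mem[of y]] by (simp add: gap_def T_S[OF assms] algebra_simps)

text \<open>Writing \<open>y = T z\<close>, the gap is the error of the tangent of \<open>f0\<close> at \<open>z\<close>, hence at most the increment of
  the slope \<open>T\<close> times that of the argument. Both are controlled by the difference of the quantiles.\<close>

lemma gap_upper:
  assumes x: "x \<in> {a0..b0}" and y: "y \<in> {a1..b1}"
  shows "gap x y \<le> (cdf \<mu>0 x - cdf \<mu>1 y)\<^sup>2 / l\<^sup>2"
proof -
  define z where "z = S y"
  have z: "z \<in> {a0..b0}" "T z = y" "cdf \<mu>0 z = cdf \<mu>1 y"
    using S_mem[of y] T_S[OF y] cdf_S by (auto simp: z_def)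
  define d where "d = \<bar>cdf \<mu>0 x - cdf \<mu>1 y\<bar>"
  have d: "\<bar>x - z\<bar> \<le> d / l" "\<bar>T x - y\<bar> \<le> d / l"
    using X.cdf_dist_ge[OF x z(1)] Y.cdf_dist_ge[OF T_mem[of x] y] X.l_pos
    by (simp_all add: d_def z cdf_T field_simps)
  have "gap x y \<le> (T x - y) * (x - z)"
    using f0_subgradient[OF z(1) x] gap_eq[OF y, of x]
    by (simp add: z_def[symmetric] algebra_simps)
  also have "\<dots> \<le> \<bar>T x - y\<bar> * \<bar>x - z\<bar>" by (metis abs_ge_self abs_mult)
  also have "\<dots> \<le> (d / l) * (d / l)" using d by (intro mult_mono) auto
  also have "\<dots> = (cdf \<mu>0 x - cdf \<mu>1 y)\<^sup>2 / l\<^sup>2"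
    by (simp add: d_def power2_eq_square)
  finally show ?thesis .
qed

text \<open>Two subgradient inequalities, from \<open>S y\<close> to the midpoint of \<open>x\<close> and \<open>S y\<close> and from there to \<open>x\<close>,
  see the strict monotonicity of \<open>T\<close>.\<close>

lemma gap_lower:
  assumes x: "x \<in> {a0..b0}" and y: "y \<in> {a1..b1}"
  shows "(l / L) ^ 3 / 4 * (y - T x)\<^sup>2 \<le> gap x y"
proof -
  define z where "z = S y"
  have z: "z \<in> {a0..b0}" "T z = y" using S_mem[of y] T_S[OF y] by (auto simp: z_def)
  define m where "m = (x + z) / 2"
  have m: "m \<in> {a0..b0}" using x z(1) by (auto simp: m_def)
  define r where "r = l / L"
  have r: "0 < r" using X.l_pos X.L_pos by (simp add: r_def)
  have "(T m - y) * (x - m) \<le> gap x y"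
    using f0_subgradient[OF x m] f0_subgradient[OF m z(1)] gap_eq[OF y, of x] z
    by (simp add: z_def[symmetric] algebra_simps)
  moreover have "(T m - y) * (x - m) = \<bar>T m - T z\<bar> * \<bar>m - z\<bar>"
  proof -
    have "x - m = m - z" by (simp add: m_def field_simps)
    moreover have "(T m - T z) * (m - z) = \<bar>T m - T z\<bar> * \<bar>m - z\<bar>"
      using T_mono[of m z] T_mono[of z m] by (cases "m \<le> z") (simp_all add: algebra_simps)
    ultimately show ?thesis by (simp add: z)
  qed
  moreover have "r * (x - z)\<^sup>2 / 4 \<le> \<bar>T m - T z\<bar> * \<bar>m - z\<bar>"
  proof -
    have mz: "\<bar>m - z\<bar> = \<bar>x - z\<bar> / 2" by (simp add: m_def field_simps)
    have "r * (x - z)\<^sup>2 / 4 = r * \<bar>m - z\<bar> * \<bar>m - z\<bar>"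
      by (simp add: mz power2_eq_square flip: abs_mult)
    also have "\<dots> \<le> \<bar>T m - T z\<bar> * \<bar>m - z\<bar>"
      using T_expansion[OF m z(1)] X.L_pos
      by (intro mult_right_mono) (simp_all add: r_def pos_divide_le_eq mult.commute)
    finally show ?thesis .
  qed
  moreover have sq: "r\<^sup>2 * (y - T x)\<^sup>2 \<le> (x - z)\<^sup>2"
  proof -
    have "r * \<bar>y - T x\<bar> \<le> \<bar>x - z\<bar>"
      using T_lipschitz[of x z] X.L_pos by (simp add: r_def z field_simps abs_minus_commute)
    then have "(r * \<bar>y - T x\<bar>)\<^sup>2 \<le> \<bar>x - z\<bar>\<^sup>2" using r by (intro power_mono) auto
    then show ?thesis by (simp add: power_mult_distrib)
  qed
  have "r * (r\<^sup>2 * (y - T x)\<^sup>2) / 4 \<le> r * (x - z)\<^sup>2 / 4"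
    using r by (intro divide_right_mono mult_left_mono sq) auto
  moreover have "r ^ 3 / 4 * (y - T x)\<^sup>2 = r * (r\<^sup>2 * (y - T x)\<^sup>2) / 4"
    by (simp add: power3_eq_cube power2_eq_square)
  ultimately show ?thesis unfolding r_def[symmetric] by linarith
qed

end

section \<open>The energy of the optimal plan\<close>

context interval_measure
begin

text \<open>A block is a difference of two sublevel sets of the distribution function.\<close>

lemma mass_block:
  fixes N :: nat
  assumes N: "0 < N" and t: "0 < t" "t \<le> 1"
  shows "measure \<mu> {x. \<lceil>real N * cdf \<mu> x\<rceil> = \<lceil>real N * t\<rceil>} = 1 / real N"
proof -
  define k where "k = \<lceil>real N * t\<rceil>"
  have "0 < real N * t" "real N * t \<le> real N" using N t by auto
  then have k: "1 \<le> k" "k \<le> int N" unfolding k_def by linarith+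
  have k': "real_of_int (k - 1) / N \<in> {0..1}" "real_of_int k / N \<in> {0..1}"
    using k N by simp_all
  have "{x. \<lceil>real N * cdf \<mu> x\<rceil> = k} = {x. cdf \<mu> x \<le> k / N} - {x. cdf \<mu> x \<le> (k - 1) / N}"
    using N by (auto simp: ceiling_eq_iff pos_le_divide_eq mult.commute)
  then have "measure \<mu> {x. \<lceil>real N * cdf \<mu> x\<rceil> = k} =
      measure \<mu> ({x. cdf \<mu> x \<le> k / N} - {x. cdf \<mu> x \<le> (k - 1) / N})" by simp
  also have "\<dots> = measure \<mu> {x. cdf \<mu> x \<le> k / N} - measure \<mu> {x. cdf \<mu> x \<le> (k - 1) / N}"
  proof (rule finite_measure_Diff)
    show "{x. cdf \<mu> x \<le> k / N} \<in> sets \<mu>" "{x. cdf \<mu> x \<le> (k - 1) / N} \<in> sets \<mu>"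
      using borel_measurable_continuous_onI[OF continuous_cdf[of UNIV]] by simp_all
    show "{x. cdf \<mu> x \<le> (k - 1) / N} \<subseteq> {x. cdf \<mu> x \<le> k / N}"
    proof safe
      fix x assume "cdf \<mu> x \<le> real_of_int (k - 1) / N"
      also have "\<dots> \<le> k / N" by (intro divide_right_mono) simp_all
      finally show "cdf \<mu> x \<le> k / N" .
    qed
  qed
  also have "\<dots> = k / N - (k - 1) / N"
    using mass_cdf_le[OF k'(1)] mass_cdf_le[OF k'(2)] by simp
  also have "\<dots> = 1 / N" by (simp add: diff_divide_distrib)
  finally show ?thesis by (simp add: k_def)
qed

lemma AE_cdf_pos: "AE x in \<mu>. 0 < cdf \<mu> x"
proof -
  have "measure \<mu> {x. cdf \<mu> x \<le> 0} = 0" by (rule mass_cdf_le) simp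
  then have "AE x in \<mu>. x \<notin> {x. cdf \<mu> x \<le> 0}"
    using borel_measurable_continuous_onI[OF continuous_cdf[of UNIV]]
    by (subst (asm) prob_eq_0) simp_all
  then show ?thesis by eventually_elim simp
qed

lemma continuous_parametric_integral:
  fixes H :: "real \<times> real \<Rightarrow> real"
  assumes H: "continuous_on UNIV H"
  shows "continuous_on UNIV (\<lambda>x. LINT y|\<mu>. H (x, y))"
proof -
  have cH: "continuous_on UNIV (\<lambda>y. H (x, y))" for x
    by (rule continuous_on_compose2[OF H]) (auto intro!: continuous_intros)
  have "isCont (\<lambda>x. LINT y|\<mu>. H (x, y)) x" for x
    unfolding continuous_at_eps_delta
  proof (intro allI impI)
    fix e :: real assume "0 < e"
    define K where "K = {x - 1..x + 1} \<times> {a..b}"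
    have "uniformly_continuous_on K H"
      unfolding K_def
      by (intro compact_uniformly_continuous continuous_on_subset[OF H] compact_Times) auto
    then obtain d where d: "0 < d"
      "\<And>p q. p \<in> K \<Longrightarrow> q \<in> K \<Longrightarrow> dist q p < d \<Longrightarrow> dist (H q) (H p) < e / 2"
      unfolding uniformly_continuous_on_def using half_gt_zero[OF \<open>0 < e\<close>] by blast
    show "\<exists>d>0. \<forall>x'. dist x' x < d \<longrightarrow>
        dist (LINT y|\<mu>. H (x', y)) (LINT y|\<mu>. H (x, y)) < e"
    proof (intro exI[of _ "min d 1"] conjI allI impI)
      fix x' assume x': "dist x' x < min d 1"
      have int: "integrable \<mu> (\<lambda>y. H (x', y) - H (x, y))"
        by (intro Bochner_Integration.integrable_diff integrable_continuous cH)
      have "\<bar>LINT y|\<mu>. H (x', y) - H (x, y)\<bar> \<le> (LINT y|\<mu>. \<bar>H (x', y) - H (x, y)\<bar>)"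
        by (rule integral_abs_bound)
      also have "\<dots> \<le> (LINT y|\<mu>. e / 2)"
      proof (rule integral_mono_AE)
        show "AE y in \<mu>. \<bar>H (x', y) - H (x, y)\<bar> \<le> e / 2"
          using AE_interval
        proof eventually_elim
          case (elim y)
          then show ?case
            using d(2)[of "(x, y)" "(x', y)"] x'
            by (simp add: K_def dist_Pair_Pair dist_real_def) linarith
        qed
      qed (use int in simp_all)
      also have "\<dots> < e" using \<open>0 < e\<close> prob_space by simp
      finally show "dist (LINT y|\<mu>. H (x', y)) (LINT y|\<mu>. H (x, y)) < e"
        by (simp add: dist_real_def integrable_continuous cH)
    qed (use d in simp)
  qed
  then show ?thesis by (simp add: continuous_at_imp_continuous_on)
qed

end

context interval_pair
begin

abbreviation "\<mu>\<mu> \<equiv> \<mu>0 \<Otimes>\<^sub>M \<mu>1"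

lemma sets_pair: "sets \<mu>\<mu> = sets borel"
  by (subst borel_prod[symmetric]) (intro sets_pair_measure_cong X.events_eq_borel Y.events_eq_borel)

lemma measurable_pair_eq: "borel_measurable \<mu>\<mu> = borel_measurable borel"
  by (rule measurable_cong_sets[OF sets_pair refl])

lemma AE_rectangle: "AE z in \<mu>\<mu>. fst z \<in> {a0..b0} \<and> snd z \<in> {a1..b1}"
proof (rule P.AE_pair_measure)
  show "AE x in \<mu>0. AE y in \<mu>1. fst (x, y) \<in> {a0..b0} \<and> snd (x, y) \<in> {a1..b1}"
    using X.AE_interval
  proof eventually_elim
    case (elim x)
    show ?case using Y.AE_interval by eventually_elim (use elim in simp)
  qed
qed measurable

lemma AE_bounded:
  fixes H :: "real \<times> real \<Rightarrow> real"
  assumes "continuous_on UNIV H"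
  obtains B where "0 \<le> B" "AE z in \<mu>\<mu>. \<bar>H z\<bar> \<le> B"
proof -
  have "bounded (H ` ({a0..b0} \<times> {a1..b1}))"
    using assms by (intro compact_imp_bounded compact_continuous_image compact_Times)
      (auto intro: continuous_on_subset)
  then obtain B where B: "\<And>z. z \<in> {a0..b0} \<times> {a1..b1} \<Longrightarrow> \<bar>H z\<bar> \<le> B"
    unfolding bounded_iff real_norm_def by blast
  have "AE z in \<mu>\<mu>. \<bar>H z\<bar> \<le> max B 0"
    using AE_rectangle by eventually_elim (use B in \<open>force simp: mem_Times_iff\<close>)
  then show ?thesis by (intro that[of "max B 0"]) auto
qed

lemma integrable_pair:
  fixes H :: "real \<times> real \<Rightarrow> real"
  assumes "continuous_on UNIV H"
  shows "integrable \<mu>\<mu> H"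
proof -
  obtain B where "AE z in \<mu>\<mu>. \<bar>H z\<bar> \<le> B" using AE_bounded[OF assms] .
  then show ?thesis
    using borel_measurable_continuous_onI[OF assms]
    by (intro P.integrable_const_bound[of _ B]) (simp_all add: measurable_pair_eq)
qed

lemma integrable_bounded_times:
  fixes H \<rho> :: "real \<times> real \<Rightarrow> real"
  assumes H: "continuous_on UNIV H"
    and \<rho>: "\<rho> \<in> borel_measurable borel" "AE z in \<mu>\<mu>. \<bar>\<rho> z\<bar> \<le> B"
  shows "integrable \<mu>\<mu> (\<lambda>z. \<rho> z * H z)"
proof -
  obtain B' where B': "0 \<le> B'" "AE z in \<mu>\<mu>. \<bar>H z\<bar> \<le> B'" using AE_bounded[OF H] .
  have "AE z in \<mu>\<mu>. norm (\<rho> z * H z) \<le> B * B'"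
    using \<rho>(2) B'(2) by eventually_elim (auto simp: abs_mult intro!: mult_mono)
  then show ?thesis
    using borel_measurable_continuous_onI[OF H] \<rho>(1)
    by (intro P.integrable_const_bound[of _ "B * B'"]) (simp_all add: measurable_pair_eq)
qed

lemma coupling_marginals:
  fixes h :: "real \<Rightarrow> real" and \<rho> :: "real \<times> real \<Rightarrow> real"
  assumes \<pi>: "\<pi> \<in> couplings \<mu>0 \<mu>1" "\<pi> = density \<mu>\<mu> (\<lambda>z. ennreal (\<rho> z))"
    and \<rho>: "\<rho> \<in> borel_measurable borel" "\<And>z. 0 \<le> \<rho> z"
    and h: "continuous_on UNIV h"
  shows "(LINT z|\<mu>\<mu>. \<rho> z * h (fst z)) = (LINT x|\<mu>0. h x)"
    and "(LINT z|\<mu>\<mu>. \<rho> z * h (snd z)) = (LINT y|\<mu>1. h y)"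
proof -
  have sets_\<pi>: "sets \<pi> = sets (borel :: (real \<times> real) measure)"
    and fst: "distr \<pi> borel fst = \<mu>0" and snd: "distr \<pi> borel snd = \<mu>1"
    using \<pi>(1) by (auto simp: couplings_def)
  have m: "borel_measurable \<pi> = borel_measurable (borel :: (real \<times> real) measure)"
    by (rule measurable_cong_sets[OF sets_\<pi> refl])
  have h': "h \<in> borel_measurable borel" by (rule borel_measurable_continuous_onI[OF h])
  have fs: "fst \<in> borel_measurable (borel :: (real \<times> real) measure)"
    "snd \<in> borel_measurable (borel :: (real \<times> real) measure)"
    by (intro borel_measurable_continuous_onI continuous_intros)+
  have "(LINT x|distr \<pi> borel fst. h x) = (LINT z|\<pi>. h (fst z))"
    by (rule integral_distr) (use h' fs in \<open>simp_all add: m\<close>)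
  also have "\<dots> = (LINT z|\<mu>\<mu>. \<rho> z *\<^sub>R h (fst z))"
    unfolding \<pi>(2)
    by (rule integral_density) (use h' fs \<rho> in \<open>simp_all add: measurable_pair_eq\<close>)
  finally show "(LINT z|\<mu>\<mu>. \<rho> z * h (fst z)) = (LINT x|\<mu>0. h x)"
    by (simp add: fst)
  have "(LINT x|distr \<pi> borel snd. h x) = (LINT z|\<pi>. h (snd z))"
    by (rule integral_distr) (use h' fs in \<open>simp_all add: m\<close>)
  also have "\<dots> = (LINT z|\<mu>\<mu>. \<rho> z *\<^sub>R h (snd z))"
    unfolding \<pi>(2)
    by (rule integral_density) (use h' fs \<rho> in \<open>simp_all add: measurable_pair_eq\<close>)
  finally show "(LINT z|\<mu>\<mu>. \<rho> z * h (snd z)) = (LINT y|\<mu>1. h y)"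
    by (simp add: snd)
qed

lemma density_in_couplings:
  fixes \<rho> :: "real \<times> real \<Rightarrow> ennreal"
  assumes \<rho>: "\<rho> \<in> borel_measurable borel"
    and fst1: "AE x in \<mu>0. (\<integral>\<^sup>+y. \<rho> (x, y) \<partial>\<mu>1) = 1"
    and snd1: "AE y in \<mu>1. (\<integral>\<^sup>+x. \<rho> (x, y) \<partial>\<mu>0) = 1"
  shows "density \<mu>\<mu> \<rho> \<in> couplings \<mu>0 \<mu>1"
proof -
  have \<rho>': "\<rho> \<in> borel_measurable \<mu>\<mu>" using \<rho> by (simp add: measurable_pair_eq)
  have "distr (density \<mu>\<mu> \<rho>) borel fst = \<mu>0"
  proof (rule measure_eqI)
    fix A :: "real set" assume "A \<in> sets (distr (density \<mu>\<mu> \<rho>) borel fst)"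
    then have A[measurable]: "A \<in> sets borel" by simp
    have pre: "fst -` A \<inter> space \<mu>\<mu> \<in> sets \<mu>\<mu>"
      by (rule measurable_sets[OF measurable_fst]) simp
    have "emeasure (distr (density \<mu>\<mu> \<rho>) borel fst) A =
        (\<integral>\<^sup>+z. \<rho> z * indicator (fst -` A \<inter> space \<mu>\<mu>) z \<partial>\<mu>\<mu>)"
      using \<rho>' pre by (subst emeasure_distr) (simp_all add: emeasure_density)
    also have "\<dots> = (\<integral>\<^sup>+z. \<rho> z * indicator A (fst z) \<partial>\<mu>\<mu>)"
      by (intro nn_integral_cong) (auto simp: indicator_def)
    also have "\<dots> = (\<integral>\<^sup>+x. (\<integral>\<^sup>+y. \<rho> (x, y) * indicator A x \<partial>\<mu>1) \<partial>\<mu>0)"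
      using \<rho>' by (subst Y.nn_integral_fst[symmetric]) auto
    also have "\<dots> = (\<integral>\<^sup>+x. indicator A x \<partial>\<mu>0)"
    proof (rule nn_integral_cong_AE)
      show "AE x in \<mu>0. (\<integral>\<^sup>+y. \<rho> (x, y) * indicator A x \<partial>\<mu>1) = indicator A x"
        using fst1
      proof eventually_elim
        case (elim x)
        then show ?case by (auto simp: indicator_def)
      qed
    qed
    also have "\<dots> = emeasure \<mu>0 A" by simp
    finally show "emeasure (distr (density \<mu>\<mu> \<rho>) borel fst) A = emeasure \<mu>0 A" .
  qed simp
  moreover have "distr (density \<mu>\<mu> \<rho>) borel snd = \<mu>1"
  proof (rule measure_eqI)
    fix A :: "real set" assume "A \<in> sets (distr (density \<mu>\<mu> \<rho>) borel snd)"
    then have A[measurable]: "A \<in> sets borel" by simp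
    have pre: "snd -` A \<inter> space \<mu>\<mu> \<in> sets \<mu>\<mu>"
      by (rule measurable_sets[OF measurable_snd]) simp
    have "emeasure (distr (density \<mu>\<mu> \<rho>) borel snd) A =
        (\<integral>\<^sup>+z. \<rho> z * indicator (snd -` A \<inter> space \<mu>\<mu>) z \<partial>\<mu>\<mu>)"
      using \<rho>' pre by (subst emeasure_distr) (simp_all add: emeasure_density)
    also have "\<dots> = (\<integral>\<^sup>+z. \<rho> z * indicator A (snd z) \<partial>\<mu>\<mu>)"
      by (intro nn_integral_cong) (auto simp: indicator_def)
    also have "\<dots> = (\<integral>\<^sup>+y. (\<integral>\<^sup>+x. \<rho> (x, y) * indicator A y \<partial>\<mu>0) \<partial>\<mu>1)"
      using \<rho>' by (subst P.nn_integral_snd[symmetric]) auto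
    also have "\<dots> = (\<integral>\<^sup>+y. indicator A y \<partial>\<mu>1)"
    proof (rule nn_integral_cong_AE)
      show "AE y in \<mu>1. (\<integral>\<^sup>+x. \<rho> (x, y) * indicator A y \<partial>\<mu>0) = indicator A y"
        using snd1
      proof eventually_elim
        case (elim y)
        then show ?case by (auto simp: indicator_def)
      qed
    qed
    also have "\<dots> = emeasure \<mu>1 A" by simp
    finally show "emeasure (distr (density \<mu>\<mu> \<rho>) borel snd) A = emeasure \<mu>1 A" .
  qed simp
  moreover have "prob_space (density \<mu>\<mu> \<rho>)"
  proof (rule prob_space_distrD)
    show "fst \<in> measurable (density \<mu>\<mu> \<rho>) borel" by simp
    show "prob_space (distr (density \<mu>\<mu> \<rho>) borel fst)"
      using calculation X.prob_space_axioms by simp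
  qed
  moreover have "sets (density \<mu>\<mu> \<rho>) = sets borel" by (simp only: sets_density sets_pair)
  ultimately show ?thesis unfolding couplings_def by blast
qed

text \<open>A competitor concentrated near the graph of \<open>T\<close>: cut both intervals into \<open>N\<close> pieces of mass
  \<open>1 / N\<close> and couple corresponding pieces independently. Ceilings rather than floors make the
  pieces half-open on the left, so that the quantile \<open>1\<close> belongs to the last of the \<open>N\<close> pieces and only
  the null quantile \<open>0\<close> is exceptional.\<close>

definition block_density :: "nat \<Rightarrow> real \<times> real \<Rightarrow> real" where
  "block_density N z =
     (if \<lceil>real N * cdf \<mu>0 (fst z)\<rceil> = \<lceil>real N * cdf \<mu>1 (snd z)\<rceil> then real N else 0)"

lemma measurable_block_density: "block_density N \<in> borel_measurable borel"
proof -
  have [measurable]: "cdf \<mu>0 \<in> borel_measurable borel" "cdf \<mu>1 \<in> borel_measurable borel"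
    using X.continuous_cdf Y.continuous_cdf by (auto intro: borel_measurable_continuous_onI)
  have "block_density N \<in> borel_measurable (borel \<Otimes>\<^sub>M borel)"
    unfolding block_density_def by measurable
  then show ?thesis by (simp add: borel_prod)
qed

lemma block_coupling:
  assumes "0 < N"
  shows "density \<mu>\<mu> (\<lambda>z. ennreal (block_density N z)) \<in> couplings \<mu>0 \<mu>1"
proof (rule density_in_couplings)
  show "(\<lambda>z. ennreal (block_density N z)) \<in> borel_measurable borel"
    using measurable_block_density by simp
  have cdf_meas: "cdf \<mu>0 \<in> borel_measurable borel" "cdf \<mu>1 \<in> borel_measurable borel"
    using X.continuous_cdf Y.continuous_cdf by (auto intro: borel_measurable_continuous_onI)
  have total: "(\<integral>\<^sup>+x. ennreal (if x \<in> A then real N else 0) \<partial>\<mu>) = 1"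
    if "finite_measure \<mu>" "A \<in> sets \<mu>" "measure \<mu> A = 1 / real N" for A and \<mu> :: "real measure"
  proof -
    interpret finite_measure \<mu> by fact
    have "(\<integral>\<^sup>+x. ennreal (if x \<in> A then real N else 0) \<partial>\<mu>) =
        (\<integral>\<^sup>+x. ennreal (real N) * indicator A x \<partial>\<mu>)"
      by (intro nn_integral_cong) (auto simp: indicator_def)
    also have "\<dots> = ennreal (real N) * ennreal (1 / real N)"
      using that by (simp add: nn_integral_cmult_indicator emeasure_eq_measure)
    also have "\<dots> = 1" using assms by (simp flip: ennreal_mult)
    finally show ?thesis .
  qed
  show "AE x in \<mu>0. (\<integral>\<^sup>+y. ennreal (block_density N (x, y)) \<partial>\<mu>1) = 1"
    using X.AE_cdf_pos
  proof eventually_elim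
    case (elim x)
    let ?A = "{y. \<lceil>real N * cdf \<mu>1 y\<rceil> = \<lceil>real N * cdf \<mu>0 x\<rceil>}"
    have "?A \<in> sets \<mu>1" using cdf_meas by simp
    moreover have "measure \<mu>1 ?A = 1 / real N"
      using Y.mass_block[OF assms elim] X.cdf_mem[of x] by simp
    ultimately show ?case
      using total[OF Y.finite_measure_axioms, of ?A]
      by (simp add: block_density_def eq_commute[of "\<lceil>real N * cdf \<mu>0 x\<rceil>"])
  qed
  show "AE y in \<mu>1. (\<integral>\<^sup>+x. ennreal (block_density N (x, y)) \<partial>\<mu>0) = 1"
    using Y.AE_cdf_pos
  proof eventually_elim
    case (elim y)
    let ?A = "{x. \<lceil>real N * cdf \<mu>0 x\<rceil> = \<lceil>real N * cdf \<mu>1 y\<rceil>}"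
    have "?A \<in> sets \<mu>0" using cdf_meas by simp
    moreover have "measure \<mu>0 ?A = 1 / real N"
      using X.mass_block[OF assms elim] Y.cdf_mem[of y] by simp
    ultimately show ?case
      using total[OF X.finite_measure_axioms, of ?A] by (simp add: block_density_def)
  qed
qed

end

context contact_pair
begin

abbreviation "Gap \<equiv> \<lambda>z. gap (fst z) (snd z)"

lemma continuous_Gap: "continuous_on UNIV Gap"
  unfolding gap_def
  by (intro continuous_intros continuous_on_compose2[OF continuous_f0]
      continuous_on_compose2[OF continuous_g0]) auto

text \<open>Since \<open>(x - y)\<^sup>2 / 2\<close> is the gap plus a function of \<open>x\<close> and a function of \<open>y\<close>, all couplings share the
  same \<open>base_cost\<close>, and minimizing the cost means minimizing the \<open>excess\<close>.\<close>

definition base_cost :: real where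
  "base_cost = (LINT x|\<mu>0. x\<^sup>2 / 2 - f0 x) + (LINT y|\<mu>1. y\<^sup>2 / 2 - g0 y)"

definition excess :: "real \<Rightarrow> (real \<times> real \<Rightarrow> real) \<Rightarrow> real" where
  "excess \<epsilon> \<rho> = (LINT z|\<mu>\<mu>. \<rho> z * Gap z) + \<epsilon> / 2 * (LINT z|\<mu>\<mu>. (\<rho> z)\<^sup>2)"

lemma qot_cost_density:
  fixes \<rho> :: "real \<times> real \<Rightarrow> real"
  assumes \<pi>: "\<pi> \<in> couplings \<mu>0 \<mu>1" "\<pi> = density \<mu>\<mu> (\<lambda>z. ennreal (\<rho> z))"
    and \<rho>: "\<rho> \<in> borel_measurable borel" "\<And>z. 0 \<le> \<rho> z" "AE z in \<mu>\<mu>. \<bar>\<rho> z\<bar> \<le> B"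
    and \<epsilon>: "0 \<le> \<epsilon>"
  shows "qot_cost \<epsilon> \<mu>0 \<mu>1 \<pi> = ennreal (base_cost + excess \<epsilon> \<rho>)"
    and "0 \<le> base_cost + excess \<epsilon> \<rho>"
proof -
  let ?c = "\<lambda>z :: real \<times> real. (fst z - snd z)\<^sup>2 / 2"
  let ?A = "\<lambda>x. x\<^sup>2 / 2 - f0 x" and ?B = "\<lambda>y. y\<^sup>2 / 2 - g0 y"
  have cA: "continuous_on UNIV ?A" and cB: "continuous_on UNIV ?B"
    by (intro continuous_intros continuous_f0 continuous_g0; simp)+
  have cA': "continuous_on UNIV (\<lambda>z :: real \<times> real. ?A (fst z))"
    and cB': "continuous_on UNIV (\<lambda>z :: real \<times> real. ?B (snd z))"
    by (rule continuous_on_compose2[OF cA] continuous_on_compose2[OF cB];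
        auto intro!: continuous_intros)+
  have cc: "continuous_on UNIV ?c" by (intro continuous_intros) auto
  note int = integrable_bounded_times[OF _ \<rho>(1,3)]
  have meas: "\<rho> \<in> borel_measurable \<mu>\<mu>" using \<rho>(1) by (simp add: measurable_pair_eq)
  have meas_c: "?c \<in> borel_measurable \<mu>\<mu>"
    using borel_measurable_continuous_onI[OF cc] by (simp add: measurable_pair_eq)
  have ac: "absolutely_continuous \<mu>\<mu> \<pi>"
    unfolding \<pi>(2) by (rule absolutely_continuousI_density) (use meas in simp)
  have "(LINT z|\<mu>\<mu>. \<rho> z * ?c z) = (LINT z|\<mu>\<mu>. \<rho> z * Gap z + (\<rho> z * ?A (fst z) + \<rho> z * ?B (snd z)))"
    by (intro Bochner_Integration.integral_cong refl)
      (simp add: gap_def power2_eq_square field_simps)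
  also have "\<dots> = (LINT z|\<mu>\<mu>. \<rho> z * Gap z) + base_cost"
    using int[OF continuous_Gap] int[OF cA'] int[OF cB']
      coupling_marginals(1)[OF \<pi> \<rho>(1,2) cA] coupling_marginals(2)[OF \<pi> \<rho>(1,2) cB]
    by (simp add: base_cost_def)
  finally have cost: "(LINT z|\<mu>\<mu>. \<rho> z * ?c z) = base_cost + (LINT z|\<mu>\<mu>. \<rho> z * Gap z)"
    by simp
  have "integrable \<mu>\<mu> (\<lambda>z. (\<rho> z)\<^sup>2)"
  proof (rule P.integrable_const_bound[of _ "B\<^sup>2"])
    show "AE z in \<mu>\<mu>. norm ((\<rho> z)\<^sup>2) \<le> B\<^sup>2"
      using \<rho>(3) by eventually_elim (use \<rho>(2) in \<open>simp add: power_mono\<close>)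
  qed (use meas in simp)
  then have sq: "(\<integral>\<^sup>+z. (RN_deriv \<mu>\<mu> \<pi> z)\<^sup>2 \<partial>\<mu>\<mu>) = ennreal (LINT z|\<mu>\<mu>. (\<rho> z)\<^sup>2)"
  proof (subst nn_integral_eq_integral[symmetric], assumption)
    have "AE z in \<mu>\<mu>. ennreal (\<rho> z) = RN_deriv \<mu>\<mu> \<pi> z"
      by (rule P.RN_deriv_unique) (use meas \<pi>(2) in simp_all)
    then show "(\<integral>\<^sup>+z. (RN_deriv \<mu>\<mu> \<pi> z)\<^sup>2 \<partial>\<mu>\<mu>) = (\<integral>\<^sup>+z. ennreal ((\<rho> z)\<^sup>2) \<partial>\<mu>\<mu>)"
      by (intro nn_integral_cong_AE, eventually_elim) (metis ennreal_power \<rho>(2))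
  qed simp
  have lin: "(\<integral>\<^sup>+z. ennreal (?c z) \<partial>\<pi>) = ennreal (LINT z|\<mu>\<mu>. \<rho> z * ?c z)"
  proof -
    have "(\<integral>\<^sup>+z. ennreal (?c z) \<partial>\<pi>) = (\<integral>\<^sup>+z. ennreal (\<rho> z) * ennreal (?c z) \<partial>\<mu>\<mu>)"
      unfolding \<pi>(2) by (rule nn_integral_density) (use meas meas_c in simp_all)
    also have "\<dots> = (\<integral>\<^sup>+z. ennreal (\<rho> z * ?c z) \<partial>\<mu>\<mu>)"
      by (simp only: ennreal_mult'[OF \<rho>(2)])
    also have "\<dots> = ennreal (LINT z|\<mu>\<mu>. \<rho> z * ?c z)"
      by (rule nn_integral_eq_integral[OF int[OF cc]]) (use \<rho>(2) in simp)
    finally show ?thesis .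
  qed
  have nonneg: "0 \<le> (LINT z|\<mu>\<mu>. \<rho> z * ?c z)" "0 \<le> \<epsilon> / 2 * (LINT z|\<mu>\<mu>. (\<rho> z)\<^sup>2)"
    using \<rho>(2) \<epsilon> by (auto intro!: Bochner_Integration.integral_nonneg mult_nonneg_nonneg)
  have split: "base_cost + excess \<epsilon> \<rho> = (LINT z|\<mu>\<mu>. \<rho> z * ?c z) + \<epsilon> / 2 * (LINT z|\<mu>\<mu>. (\<rho> z)\<^sup>2)"
    unfolding excess_def cost by (rule add.assoc[symmetric])
  show "0 \<le> base_cost + excess \<epsilon> \<rho>"
    unfolding split by (rule add_nonneg_nonneg[OF nonneg])
  have "qot_cost \<epsilon> \<mu>0 \<mu>1 \<pi> = ennreal (LINT z|\<mu>\<mu>. \<rho> z * ?c z) + ennreal (\<epsilon> / 2 * (LINT z|\<mu>\<mu>. (\<rho> z)\<^sup>2))"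
  proof -
    have "ennreal (\<epsilon> / 2) * ennreal (LINT z|\<mu>\<mu>. (\<rho> z)\<^sup>2) = ennreal (\<epsilon> / 2 * (LINT z|\<mu>\<mu>. (\<rho> z)\<^sup>2))"
      by (rule ennreal_mult'[symmetric]) (use \<epsilon> in simp)
    then show ?thesis unfolding qot_cost_def by (simp only: if_P[OF ac] lin sq)
  qed
  also have "\<dots> = ennreal (base_cost + excess \<epsilon> \<rho>)"
    unfolding split by (rule ennreal_plus[OF nonneg, symmetric])
  finally show "qot_cost \<epsilon> \<mu>0 \<mu>1 \<pi> = ennreal (base_cost + excess \<epsilon> \<rho>)" .
qed

text \<open>Within a block the quantiles differ by at most \<open>1 / N\<close>, so the gap is of order \<open>1 / N\<^sup>2\<close>, while the
  squared density is \<open>N\<close> times the density and so has integral \<open>N\<close>.\<close>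

lemma excess_block:
  assumes N: "0 < N"
  shows "excess \<epsilon> (block_density N) \<le> 1 / (l * real N)\<^sup>2 + \<epsilon> / 2 * real N"
proof -
  let ?\<rho> = "block_density N"
  have bnd: "AE z in \<mu>\<mu>. \<bar>?\<rho> z\<bar> \<le> real N" and nonneg: "0 \<le> ?\<rho> z" for z
    by (simp_all add: block_density_def)
  note int = integrable_bounded_times[OF _ measurable_block_density bnd]
  have "(LINT z|\<mu>\<mu>. ?\<rho> z * 1) = (LINT x|\<mu>0. 1)"
    by (rule coupling_marginals(1)[OF block_coupling[OF N] refl measurable_block_density nonneg])
      simp
  then have mass: "(LINT z|\<mu>\<mu>. ?\<rho> z) = 1" using X.prob_space by simp
  have "(LINT z|\<mu>\<mu>. ?\<rho> z * Gap z) \<le> (LINT z|\<mu>\<mu>. ?\<rho> z * (1 / (l * real N)\<^sup>2))"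
  proof (rule integral_mono_AE)
    show "integrable \<mu>\<mu> (\<lambda>z. ?\<rho> z * Gap z)" by (rule int[OF continuous_Gap])
    show "integrable \<mu>\<mu> (\<lambda>z. ?\<rho> z * (1 / (l * real N)\<^sup>2))" by (rule int) simp
    show "AE z in \<mu>\<mu>. ?\<rho> z * Gap z \<le> ?\<rho> z * (1 / (l * real N)\<^sup>2)"
      using AE_rectangle
    proof eventually_elim
      case (elim z)
      let ?s = "cdf \<mu>0 (fst z)" and ?t = "cdf \<mu>1 (snd z)"
      show ?case
      proof (cases "\<lceil>real N * ?s\<rceil> = \<lceil>real N * ?t\<rceil>")
        case True
        then have "\<bar>real N * ?s - real N * ?t\<bar> \<le> 1" by linarith
        then have "(real N * (?s - ?t))\<^sup>2 \<le> 1"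
          unfolding right_diff_distrib by (simp add: abs_square_le_1)
        then have "(?s - ?t)\<^sup>2 * (real N)\<^sup>2 \<le> 1"
          unfolding power_mult_distrib by (simp add: mult.commute)
        then have "(?s - ?t)\<^sup>2 \<le> 1 / (real N)\<^sup>2"
          using N by (subst pos_le_divide_eq) simp_all
        then have "(?s - ?t)\<^sup>2 / l\<^sup>2 \<le> 1 / (real N)\<^sup>2 / l\<^sup>2" by (rule divide_right_mono) simp
        then have "Gap z \<le> 1 / (l * real N)\<^sup>2"
          using gap_upper[of "fst z" "snd z"] elim by (simp add: power_mult_distrib mult.commute)
        then show ?thesis by (intro mult_left_mono nonneg)
      qed (simp add: block_density_def)
    qed
  qed
  also have "\<dots> = 1 / (l * real N)\<^sup>2" by (simp only: integral_mult_left_zero mass mult_1_left)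
  finally have "(LINT z|\<mu>\<mu>. ?\<rho> z * Gap z) \<le> 1 / (l * real N)\<^sup>2" .
  moreover have "(LINT z|\<mu>\<mu>. (?\<rho> z)\<^sup>2) = (LINT z|\<mu>\<mu>. real N * ?\<rho> z)"
    by (intro Bochner_Integration.integral_cong) (auto simp: block_density_def power2_eq_square)
  then have "(LINT z|\<mu>\<mu>. (?\<rho> z)\<^sup>2) = real N" by (simp add: mass)
  ultimately show ?thesis by (simp add: excess_def)
qed

lemma excess_plan_le:
  fixes \<rho> :: "real \<times> real \<Rightarrow> real"
  assumes plan: "is_qot_plan \<epsilon> \<mu>0 \<mu>1 \<pi>" and \<pi>: "\<pi> = density \<mu>\<mu> (\<lambda>z. ennreal (\<rho> z))"
    and \<rho>: "\<rho> \<in> borel_measurable borel" "\<And>z. 0 \<le> \<rho> z" "AE z in \<mu>\<mu>. \<bar>\<rho> z\<bar> \<le> B"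
    and \<epsilon>: "0 \<le> \<epsilon>" and N: "0 < N"
  shows "excess \<epsilon> \<rho> \<le> 1 / (l * real N)\<^sup>2 + \<epsilon> / 2 * real N"
proof -
  have coup: "\<pi> \<in> couplings \<mu>0 \<mu>1" using plan by (simp add: is_qot_plan_def)
  have bnd: "AE z in \<mu>\<mu>. \<bar>block_density N z\<bar> \<le> real N" and nonneg: "0 \<le> block_density N z" for z
    by (simp_all add: block_density_def)
  let ?\<pi> = "density \<mu>\<mu> (\<lambda>z. ennreal (block_density N z))"
  have "qot_cost \<epsilon> \<mu>0 \<mu>1 \<pi> \<le> qot_cost \<epsilon> \<mu>0 \<mu>1 ?\<pi>"
    using plan block_coupling[OF N] by (simp add: is_qot_plan_def)
  then have "ennreal (base_cost + excess \<epsilon> \<rho>) \<le> ennreal (base_cost + excess \<epsilon> (block_density N))"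
    by (simp only: qot_cost_density(1)[OF coup \<pi> \<rho> \<epsilon>]
        qot_cost_density(1)[OF block_coupling[OF N] refl measurable_block_density nonneg bnd \<epsilon>])
  then have "excess \<epsilon> \<rho> \<le> excess \<epsilon> (block_density N)"
    using qot_cost_density(2)[OF block_coupling[OF N] refl measurable_block_density nonneg bnd \<epsilon>]
    by (simp add: ennreal_le_iff)
  then show ?thesis using excess_block[OF N, of \<epsilon>] by linarith
qed

end

section \<open>Subgradients of the regularized potentials\<close>

context interval_measure
begin

lemma integrable_indicat: "A \<in> sets borel \<Longrightarrow> integrable \<mu> (indicat_real A)"
  by (rule integrable_real_indicator) (simp_all add: less_top[symmetric])

text \<open>The integral below is jointly convex in \<open>x\<close> and the value \<open>f x\<close>. Differentiating the equation
  implicitly gives a subgradient of \<open>f\<close> at \<open>x\<close>, namely the mean of \<open>y\<close> over the section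
  \<open>{y. 0 < x * y - f x - g y}\<close>; it lies in every interval that contains the section.\<close>

lemma potential_subgradient:
  fixes f g :: "real \<Rightarrow> real"
  assumes g: "continuous_on UNIV g" and \<epsilon>: "0 < \<epsilon>"
    and eq: "\<And>x. x \<in> A \<Longrightarrow> (LINT y|\<mu>. max (x * y - f x - g y) 0) = \<epsilon>"
    and x: "x \<in> A"
    and sec: "\<And>y. y \<in> {a..b} \<Longrightarrow> 0 < x * y - f x - g y \<Longrightarrow> y \<in> {\<alpha>..\<beta>}"
  shows "\<exists>p\<in>{\<alpha>..\<beta>}. \<forall>z\<in>A. f x + p * (z - x) \<le> f z"
proof -
  define \<psi> where "\<psi> y = x * y - f x - g y" for y
  define S where "S = {y. 0 < \<psi> y}"
  have c\<psi>: "continuous_on UNIV (\<lambda>y. z * y - f z - g y)" for z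
    by (intro continuous_intros g)
  have c0: "continuous_on UNIV (\<lambda>y. max (z * y - f z - g y) 0)" for z
    by (intro continuous_intros g)
  have "open S"
    unfolding S_def \<psi>_def by (intro open_Collect_less c\<psi> continuous_intros)
  then have S: "S \<in> sets \<mu>" by simp
  have int1: "integrable \<mu> (indicat_real S)" using S by (intro integrable_indicat) simp
  have inty: "integrable \<mu> (\<lambda>y. indicat_real S y * y)"
    using integrable_mult_indicator[OF S integrable_continuous[OF continuous_on_id]] by simp
  define k where "k = measure \<mu> S"
  define m where "m = (LINT y|\<mu>. indicat_real S y * y)"
  have k1: "(LINT y|\<mu>. indicat_real S y) = k" using S by (simp add: k_def)
  have "0 < k"
  proof (rule ccontr)
    assume "\<not> 0 < k"
    then have "measure \<mu> S = 0" using measure_nonneg[of \<mu> S] by (simp add: k_def)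
    then have "AE y in \<mu>. y \<notin> S" using S by (simp add: prob_eq_0)
    then have "AE y in \<mu>. max (x * y - f x - g y) 0 = 0"
      by eventually_elim (simp add: S_def \<psi>_def)
    then have "(LINT y|\<mu>. max (x * y - f x - g y) 0) = (LINT y|\<mu>. 0)"
      using borel_measurable_continuous_onI[OF c0] by (intro integral_cong_AE) simp_all
    then show False using eq[OF x] \<epsilon> by simp
  qed
  have lo: "\<alpha> * k \<le> m"
  proof -
    have "(LINT y|\<mu>. indicat_real S y * \<alpha>) \<le> m"
      unfolding m_def
    proof (rule integral_mono_AE)
      show "AE y in \<mu>. indicat_real S y * \<alpha> \<le> indicat_real S y * y"
        using AE_interval
        by eventually_elim (use sec in \<open>auto simp: S_def \<psi>_def indicator_def\<close>)
    qed (use inty int1 in simp_all)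
    then show ?thesis by (simp add: k_def mult.commute)
  qed
  have hi: "m \<le> \<beta> * k"
  proof -
    have "m \<le> (LINT y|\<mu>. indicat_real S y * \<beta>)"
      unfolding m_def
    proof (rule integral_mono_AE)
      show "AE y in \<mu>. indicat_real S y * y \<le> indicat_real S y * \<beta>"
        using AE_interval
        by eventually_elim (use sec in \<open>auto simp: S_def \<psi>_def indicator_def\<close>)
    qed (use inty int1 in simp_all)
    then show ?thesis by (simp add: k_def mult.commute)
  qed
  have sub: "f x + m / k * (z - x) \<le> f z" if z: "z \<in> A" for z
  proof -
    have i1: "integrable \<mu> (\<lambda>y. max (x * y - f x - g y) 0)"
      by (rule integrable_continuous[OF c0])
    have i2: "integrable \<mu> (\<lambda>y. (z - x) * (indicat_real S y * y))"
      "integrable \<mu> (\<lambda>y. (f z - f x) * indicat_real S y)"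
      using inty int1 by simp_all
    have "(LINT y|\<mu>. max (x * y - f x - g y) 0 +
          ((z - x) * (indicat_real S y * y) - (f z - f x) * indicat_real S y))
        \<le> (LINT y|\<mu>. max (z * y - f z - g y) 0)"
    proof (rule integral_mono)
      show "integrable \<mu> (\<lambda>y. max (z * y - f z - g y) 0)"
        by (rule integrable_continuous[OF c0])
      show "max (x * y - f x - g y) 0 +
          ((z - x) * (indicat_real S y * y) - (f z - f x) * indicat_real S y)
          \<le> max (z * y - f z - g y) 0" for y
        by (auto simp: S_def \<psi>_def indicator_def algebra_simps)
    qed (use i1 i2 in simp)
    also have "(LINT y|\<mu>. max (x * y - f x - g y) 0 +
          ((z - x) * (indicat_real S y * y) - (f z - f x) * indicat_real S y)) =
        \<epsilon> + ((z - x) * m - (f z - f x) * k)"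
      using i1 i2 int1 inty by (simp add: eq[OF x] m_def k_def)
    finally have "(z - x) * m \<le> (f z - f x) * k" using eq[OF z] by simp
    then have "(z - x) * m / k \<le> f z - f x" using \<open>0 < k\<close> by (simp add: pos_divide_le_eq)
    then show ?thesis by (simp add: mult.commute)
  qed
  show ?thesis
    using lo hi \<open>0 < k\<close> sub
    by (intro bexI[of _ "m / k"]) (simp_all add: pos_le_divide_eq pos_divide_le_eq)
qed

lemma potential_convex:
  fixes f g :: "real \<Rightarrow> real"
  assumes g: "continuous_on UNIV g" and \<epsilon>: "0 < \<epsilon>" and A: "convex A"
    and eq: "\<And>x. x \<in> A \<Longrightarrow> (LINT y|\<mu>. max (x * y - f x - g y) 0) = \<epsilon>"
  shows "convex_on A f"
proof (rule convex_onI)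
  fix t x y :: real
  assume t: "0 < t" "t < 1" and xy: "x \<in> A" "y \<in> A"
  define c where "c = (1 - t) *\<^sub>R x + t *\<^sub>R y"
  have "c \<in> A" unfolding c_def using A xy t by (intro convexD) auto
  then obtain p where p: "\<And>z. z \<in> A \<Longrightarrow> f c + p * (z - c) \<le> f z"
    using potential_subgradient[OF g \<epsilon> eq, of A c a b] by auto
  have "(1 - t) * (f c + p * (x - c)) + t * (f c + p * (y - c)) \<le> (1 - t) * f x + t * f y"
    using t by (intro add_mono mult_left_mono p xy) auto
  moreover have "(1 - t) * (f c + p * (x - c)) + t * (f c + p * (y - c)) = f c"
    by (simp add: c_def algebra_simps)
  ultimately show "f ((1 - t) *\<^sub>R x + t *\<^sub>R y) \<le> (1 - t) * f x + t * f y"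
    by (simp add: c_def)
qed (rule A)

section \<open>Second moments over a section\<close>

text \<open>The positive part of a concave function \<open>\<psi>\<close> lives on an interval \<open>{\<alpha>..\<beta>}\<close>, on half of which it
  exceeds half of its maximum. Hence its mass cannot concentrate, and its second moment about any
  point \<open>\<tau>\<close> controls the squared distance of \<open>\<tau>\<close> from every point of \<open>{\<alpha>..\<beta>}\<close>: either \<open>\<tau>\<close> is far
  from the whole interval, or the second moment is comparable with the squared length.\<close>

lemma section_second_moment:
  fixes \<psi> :: "real \<Rightarrow> real"
  assumes \<psi>: "continuous_on UNIV \<psi>"
    and conc: "\<And>t u v. 0 \<le> t \<Longrightarrow> t \<le> 1 \<Longrightarrow> u \<in> {a..b} \<Longrightarrow> v \<in> {a..b} \<Longrightarrow>
        (1 - t) * \<psi> u + t * \<psi> v \<le> \<psi> ((1 - t) * u + t * v)"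
    and pos: "0 < (LINT y|\<mu>. max (\<psi> y) 0)"
  obtains \<alpha> \<beta> where "\<And>y. y \<in> {a..b} \<Longrightarrow> 0 < \<psi> y \<Longrightarrow> y \<in> {\<alpha>..\<beta>}"
    and "\<And>p. p \<in> {\<alpha>..\<beta>} \<Longrightarrow> (p - \<tau>)\<^sup>2 * (LINT y|\<mu>. max (\<psi> y) 0)
        \<le> 4096 * (L / l) * (LINT y|\<mu>. (y - \<tau>)\<^sup>2 * max (\<psi> y) 0)"
proof -
  define \<epsilon> where "\<epsilon> = (LINT y|\<mu>. max (\<psi> y) 0)"
  define I where "I = (LINT y|\<mu>. (y - \<tau>)\<^sup>2 * max (\<psi> y) 0)"
  have cw: "continuous_on UNIV (\<lambda>y. max (\<psi> y) 0)" by (intro continuous_intros \<psi>)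
  have cI: "continuous_on UNIV (\<lambda>y. (y - \<tau>)\<^sup>2 * max (\<psi> y) 0)" by (intro continuous_intros \<psi>)
  note iw = integrable_continuous[OF cw] and iI = integrable_continuous[OF cI]
  have "\<exists>y\<in>{a..b}. 0 < \<psi> y"
  proof (rule ccontr)
    assume "\<not> ?thesis"
    then have "AE y in \<mu>. max (\<psi> y) 0 = 0"
      using AE_interval by (elim eventually_mono) force
    then have "(LINT y|\<mu>. max (\<psi> y) 0) = (LINT y|\<mu>. 0)"
      using borel_measurable_continuous_onI[OF cw] by (intro integral_cong_AE) simp_all
    then show False using pos by simp
  qed
  then obtain y0 where y0: "y0 \<in> {a..b}" "0 < \<psi> y0" by blast
  define Z where "Z = {y \<in> {a..b}. 0 \<le> \<psi> y}"
  have "closed {y. 0 \<le> \<psi> y}" by (intro closed_Collect_le \<psi> continuous_intros)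
  moreover have "Z = {a..b} \<inter> {y. 0 \<le> \<psi> y}" by (auto simp: Z_def)
  ultimately have "compact Z" by (simp add: compact_Int_closed)
  moreover have "Z \<noteq> {}" using y0 by (auto simp: Z_def)
  ultimately obtain \<alpha> \<beta> where \<alpha>: "\<alpha> \<in> Z" "\<And>y. y \<in> Z \<Longrightarrow> \<alpha> \<le> y" and \<beta>: "\<beta> \<in> Z" "\<And>y. y \<in> Z \<Longrightarrow> y \<le> \<beta>"
    using compact_attains_inf[of Z] compact_attains_sup[of Z] by metis
  have sec: "y \<in> {\<alpha>..\<beta>}" if "y \<in> {a..b}" "0 < \<psi> y" for y
    using that \<alpha>(2)[of y] \<beta>(2)[of y] by (simp add: Z_def)
  have \<alpha>\<beta>: "\<alpha> \<in> {a..b}" "\<beta> \<in> {a..b}" "0 \<le> \<psi> \<alpha>" "0 \<le> \<psi> \<beta>" "\<alpha> \<le> \<beta>"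
    using \<alpha> \<beta> by (auto simp: Z_def)
  obtain y1 where y1: "y1 \<in> {a..b}" "\<And>y. y \<in> {a..b} \<Longrightarrow> \<psi> y \<le> \<psi> y1"
    using continuous_attains_sup[of "{a..b}" \<psi>] a_less_b continuous_on_subset[OF \<psi>] by auto
  define m where "m = \<psi> y1"
  have m: "0 < m" using y1(2)[OF y0(1)] y0(2) by (simp add: m_def)
  have y1': "y1 \<in> {\<alpha>..\<beta>}" using sec[OF y1(1)] m by (simp add: m_def)
  define len where "len = \<beta> - \<alpha>"
  have mass: "\<epsilon> \<le> m * (L * len)"
  proof -
    have "\<epsilon> \<le> (LINT y|\<mu>. m * indicat_real {\<alpha>..\<beta>} y)"
      unfolding \<epsilon>_def
    proof (rule integral_mono_AE)
      show "AE y in \<mu>. max (\<psi> y) 0 \<le> m * indicat_real {\<alpha>..\<beta>} y"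
        using AE_interval
      proof eventually_elim
        case (elim y)
        then show ?case
          using y1(2)[OF elim] sec[OF elim] m by (force simp: m_def indicator_def)
      qed
    qed (use iw integrable_indicat in simp_all)
    also have "\<dots> = m * measure \<mu> {\<alpha>..\<beta>}" by simp
    also have "\<dots> \<le> m * (L * len)"
      using mass_upper[OF \<alpha>\<beta>(5)] m by (simp add: len_def)
    finally show ?thesis .
  qed
  have "0 < \<epsilon>" using pos by (simp add: \<epsilon>_def)
  have len: "0 < len"
  proof (rule ccontr)
    assume "\<not> 0 < len"
    then have "len = 0" using \<alpha>\<beta>(5) by (simp add: len_def)
    then show False using mass \<open>0 < \<epsilon>\<close> by simp
  qed
  \<comment> \<open>Contracting \<open>{\<alpha>..\<beta>}\<close> by one half towards the maximum point gives \<open>{j..j + len / 2}\<close>.\<close>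
  define j where "j = (\<alpha> + y1) / 2"
  have half: "m / 2 \<le> \<psi> y" if y: "y \<in> {j..j + len / 2}" for y
  proof -
    \<comment> \<open>The preimage of \<open>y\<close> under the contraction; \<open>\<psi>\<close> is nonnegative there.\<close>
    define u where "u = 2 * y - y1"
    have u: "u \<in> {\<alpha>..\<beta>}" using y by (auto simp: u_def j_def len_def field_simps)
    define t where "t = (u - \<alpha>) / len"
    have t: "0 \<le> t" "t \<le> 1" using u len by (auto simp: t_def len_def)
    have "(1 - t) * \<alpha> + t * \<beta> = \<alpha> + t * len" by (simp add: len_def algebra_simps)
    also have "\<dots> = u" using len by (simp add: t_def)
    finally have "(1 - t) * \<psi> \<alpha> + t * \<psi> \<beta> \<le> \<psi> u" using conc[OF t \<alpha>\<beta>(1,2)] by simp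
    then have "0 \<le> \<psi> u" using t \<alpha>\<beta> by (smt (verit) mult_nonneg_nonneg)
    moreover have "(1 - 1/2) * \<psi> u + 1/2 * \<psi> y1 \<le> \<psi> ((1 - 1/2) * u + 1/2 * y1)"
      using u \<alpha>\<beta> by (intro conc y1) auto
    moreover have "(1 - 1/2) * u + 1/2 * y1 = y" by (simp add: u_def field_simps)
    ultimately show ?thesis by (simp add: m_def)
  qed
  have quarter: "l * m * len ^ 3 / 1024 \<le> I"
  proof -
    \<comment> \<open>The outer quarter of that interval which is the farther one from \<open>\<tau>\<close>.\<close>
    define k where "k = (if \<tau> \<le> j + len / 4 then j + 3 * len / 8 else j)"
    have K_sub: "{k..k + len / 8} \<subseteq> {j..j + len / 2}" using len by (auto simp: k_def)
    have K_in: "a \<le> k" "k + len / 8 \<le> b"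
      using len \<alpha>\<beta> y1' by (auto simp: k_def j_def len_def field_simps)
    have far: "(len / 8)\<^sup>2 \<le> (y - \<tau>)\<^sup>2" if "y \<in> {k..k + len / 8}" for y
    proof -
      have "len / 8 \<le> \<bar>y - \<tau>\<bar>" using that len by (auto simp: k_def split: if_splits)
      then have "(len / 8)\<^sup>2 \<le> \<bar>y - \<tau>\<bar>\<^sup>2" using len by (intro power_mono) auto
      then show ?thesis by simp
    qed
    have "l * m * len ^ 3 / 1024 = (len / 8)\<^sup>2 * (m / 2) * (l * (len / 8))"
      by (simp add: power2_eq_square power3_eq_cube)
    also have "\<dots> \<le> (len / 8)\<^sup>2 * (m / 2) * measure \<mu> {k..k + len / 8}"
      using mass_lower[of k "k + len / 8"] K_in len m by (intro mult_left_mono) auto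
    also have "\<dots> = (LINT y|\<mu>. (len / 8)\<^sup>2 * (m / 2) * indicat_real {k..k + len / 8} y)"
      by simp
    also have "\<dots> \<le> I"
      unfolding I_def
    proof (rule integral_mono)
      show "(len / 8)\<^sup>2 * (m / 2) * indicat_real {k..k + len / 8} y \<le> (y - \<tau>)\<^sup>2 * max (\<psi> y) 0" for y
      proof (cases "y \<in> {k..k + len / 8}")
        case True
        then have "m / 2 \<le> max (\<psi> y) 0" using half[of y] K_sub by force
        then have "(len / 8)\<^sup>2 * (m / 2) \<le> (y - \<tau>)\<^sup>2 * max (\<psi> y) 0"
          using far[OF True] m by (intro mult_mono) auto
        then show ?thesis using True by simp
      qed auto
    qed (use iI integrable_indicat in simp_all)
    finally show ?thesis .
  qed
  \<comment> \<open>The constant is \<open>4 * 1024\<close>, with \<open>4\<close> from the case distinction at \<open>2 * len\<close> and \<open>1024\<close> from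
    the estimate on the quarter.\<close>
  have main: "(p - \<tau>)\<^sup>2 * \<epsilon> \<le> 4096 * (L / l) * I" if p: "p \<in> {\<alpha>..\<beta>}" for p
  proof (cases "2 * len \<le> \<bar>p - \<tau>\<bar>")
    case True
    have "(LINT y|\<mu>. (p - \<tau>)\<^sup>2 / 4 * max (\<psi> y) 0) \<le> I"
      unfolding I_def
    proof (rule integral_mono_AE)
      show "AE y in \<mu>. (p - \<tau>)\<^sup>2 / 4 * max (\<psi> y) 0 \<le> (y - \<tau>)\<^sup>2 * max (\<psi> y) 0"
        using AE_interval
      proof eventually_elim
        case (elim y)
        show ?case
        proof (cases "0 < \<psi> y")
          case y: True
          have "\<bar>p - y\<bar> \<le> len" using sec[OF elim y] p by (auto simp: len_def)
          then have "\<bar>p - \<tau>\<bar> / 2 \<le> \<bar>y - \<tau>\<bar>"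
            using True abs_triangle_ineq[of "p - y" "y - \<tau>"] by simp
          then have "(\<bar>p - \<tau>\<bar> / 2)\<^sup>2 \<le> \<bar>y - \<tau>\<bar>\<^sup>2" by (intro power_mono) auto
          then have "(p - \<tau>)\<^sup>2 / 4 \<le> (y - \<tau>)\<^sup>2" by (simp add: power_divide)
          then show ?thesis by (intro mult_right_mono) auto
        qed simp
      qed
    qed (use iw iI in simp_all)
    then have le: "(p - \<tau>)\<^sup>2 * \<epsilon> \<le> 4 * I" using iw by (simp add: \<epsilon>_def)
    have "0 \<le> I" unfolding I_def by (intro Bochner_Integration.integral_nonneg) auto
    moreover have "4 \<le> 4096 * (L / l)" using l_le_L l_pos by (simp add: field_simps)
    ultimately have "4 * I \<le> 4096 * (L / l) * I" by (intro mult_right_mono)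
    with le show ?thesis by linarith
  next
    case False
    then have "\<bar>p - \<tau>\<bar>\<^sup>2 \<le> (2 * len)\<^sup>2" by (intro power_mono) auto
    then have "(p - \<tau>)\<^sup>2 * \<epsilon> \<le> (2 * len)\<^sup>2 * (m * (L * len))"
      using mass \<open>0 < \<epsilon>\<close> by (intro mult_mono) auto
    also have "\<dots> = 4096 * (L / l) * (l * m * len ^ 3 / 1024)"
      using l_pos by (simp add: power2_eq_square power3_eq_cube)
    also have "\<dots> \<le> 4096 * (L / l) * I"
      using quarter l_pos L_pos by (intro mult_left_mono) auto
    finally show ?thesis .
  qed
  show ?thesis by (rule that[OF sec main[unfolded \<epsilon>_def I_def]])
qed

end

section \<open>Increments controlled by a density\<close>

text \<open>An elementary substitute for integrating a derivative: locally the increments of \<open>F\<close> are at most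
  those of the right-hand side up to a slope \<open>\<eta>\<close>, hence globally; then \<open>\<eta>\<close> tends to zero. The
  increments of \<open>T\<close> only appear with a second factor \<open>v - u\<close>, so continuity removes them.\<close>

lemma increment_bound:
  fixes F E T \<Phi> :: "real \<Rightarrow> real"
  assumes ab: "a \<le> b" and "0 < l" "0 \<le> \<sigma>"
    and E: "continuous_on UNIV E" and T: "continuous_on UNIV T"
    and \<Phi>: "\<And>u v c. a \<le> u \<Longrightarrow> u \<le> v \<Longrightarrow> v \<le> b \<Longrightarrow> (\<And>s. s \<in> {u..v} \<Longrightarrow> c \<le> E s) \<Longrightarrow>
        l * c * (v - u) \<le> \<Phi> v - \<Phi> u"
    and F: "\<And>u v. a \<le> u \<Longrightarrow> u < v \<Longrightarrow> v \<le> b \<Longrightarrow>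
        \<bar>F v - F u\<bar> \<le> (\<sigma> * max (E u) (E v) + k + (T v - T u)) * (v - u)"
  shows "\<bar>F b - F a\<bar> \<le> \<sigma> / l * (\<Phi> b - \<Phi> a) + k * (b - a)"
proof -
  have approx: "\<bar>F b - F a\<bar> \<le> \<sigma> / l * (\<Phi> b - \<Phi> a) + (k + \<eta>) * (b - a)" if \<eta>: "0 < \<eta>" for \<eta>
  proof -
    define P where "P u v \<longleftrightarrow> (a \<le> u \<longrightarrow> u \<le> v \<longrightarrow> v \<le> b \<longrightarrow>
      \<bar>F v - F u\<bar> \<le> \<sigma> / l * (\<Phi> v - \<Phi> u) + (k + \<eta>) * (v - u))" for u v
    have "P a b" using ab
    proof (induction rule: Bolzano)
      case (trans u v w)
      show ?case unfolding P_def
      proof (intro impI)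
        assume "a \<le> u" "u \<le> w" "w \<le> b"
        then have "\<bar>F v - F u\<bar> \<le> \<sigma> / l * (\<Phi> v - \<Phi> u) + (k + \<eta>) * (v - u)"
          "\<bar>F w - F v\<bar> \<le> \<sigma> / l * (\<Phi> w - \<Phi> v) + (k + \<eta>) * (w - v)"
          using trans unfolding P_def by auto
        moreover have "\<bar>F w - F u\<bar> \<le> \<bar>F v - F u\<bar> + \<bar>F w - F v\<bar>" by linarith
        ultimately have "\<bar>F w - F u\<bar> \<le> (\<sigma> / l * (\<Phi> v - \<Phi> u) + (k + \<eta>) * (v - u)) +
            (\<sigma> / l * (\<Phi> w - \<Phi> v) + (k + \<eta>) * (w - v))" by linarith
        also have "\<dots> = \<sigma> / l * (\<Phi> w - \<Phi> u) + (k + \<eta>) * (w - u)"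
          by (simp only: right_diff_distrib)
        finally show "\<bar>F w - F u\<bar> \<le> \<sigma> / l * (\<Phi> w - \<Phi> u) + (k + \<eta>) * (w - u)" .
      qed
    next
      case (local s)
      define \<delta> where "\<delta> = \<eta> / (2 * (\<sigma> + 1))"
      have \<delta>: "0 < \<delta>" using \<eta> \<open>0 \<le> \<sigma>\<close> by (simp add: \<delta>_def)
      have "isCont E s" "isCont T s"
        using E T by (auto simp: continuous_on_eq_continuous_at)
      then obtain d1 d2 where d: "0 < d1" "0 < d2"
        "\<And>r. \<bar>r - s\<bar> < d1 \<Longrightarrow> \<bar>E r - E s\<bar> < \<delta>" "\<And>r. \<bar>r - s\<bar> < d2 \<Longrightarrow> \<bar>T r - T s\<bar> < \<delta>"
        unfolding continuous_at_eps_delta dist_real_def using \<delta> by metis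
      show ?case
      proof (intro exI[of _ "min d1 d2"] conjI allI impI)
        fix u v assume uv: "u \<le> s \<and> s \<le> v \<and> v - u < min d1 d2"
        have near: "\<bar>E r - E s\<bar> < \<delta>" "\<bar>T r - T s\<bar> < \<delta>" if "r \<in> {u..v}" for r
          using that uv by (auto intro!: d(3,4))
        show "P u v" unfolding P_def
        proof (intro impI)
          assume le: "a \<le> u" "u \<le> v" "v \<le> b"
          show "\<bar>F v - F u\<bar> \<le> \<sigma> / l * (\<Phi> v - \<Phi> u) + (k + \<eta>) * (v - u)"
          proof (cases "u = v")
            case False
            have *: "max (E u) (E v) \<le> (E s - \<delta>) + 2 * \<delta>" "T v - T u \<le> 2 * \<delta>"
              using near(1)[of u] near(1)[of v] near(2)[of u] near(2)[of v] le by auto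
            have \<eta>_eq: "\<sigma> * (2 * \<delta>) + 2 * \<delta> = \<eta>"
            proof -
              have "\<sigma> * (2 * \<delta>) + 2 * \<delta> = (2 * (\<sigma> + 1)) * \<delta>" by (simp add: algebra_simps)
              also have "\<dots> = \<eta>" using \<open>0 \<le> \<sigma>\<close> by (simp add: \<delta>_def)
              finally show ?thesis .
            qed
            have "l * (E s - \<delta>) * (v - u) \<le> \<Phi> v - \<Phi> u"
              by (rule \<Phi>[OF le]) (use near(1) in fastforce)
            then have "(E s - \<delta>) * (v - u) \<le> (\<Phi> v - \<Phi> u) / l"
              using \<open>0 < l\<close> by (simp add: pos_le_divide_eq mult.commute mult.left_commute)
            then have "\<sigma> * ((E s - \<delta>) * (v - u)) \<le> \<sigma> * ((\<Phi> v - \<Phi> u) / l)"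
              using \<open>0 \<le> \<sigma>\<close> by (rule mult_left_mono)
            then have \<Phi>': "\<sigma> * ((E s - \<delta>) * (v - u)) \<le> \<sigma> / l * (\<Phi> v - \<Phi> u)" by simp
            have "\<bar>F v - F u\<bar> \<le> (\<sigma> * max (E u) (E v) + k + (T v - T u)) * (v - u)"
              using F[of u v] le False by simp
            also have "\<dots> \<le> (\<sigma> * ((E s - \<delta>) + 2 * \<delta>) + k + 2 * \<delta>) * (v - u)"
              using * le \<open>0 \<le> \<sigma>\<close> by (intro mult_right_mono add_mono mult_left_mono) auto
            also have "\<dots> = \<sigma> * ((E s - \<delta>) * (v - u)) + (k + (\<sigma> * (2 * \<delta>) + 2 * \<delta>)) * (v - u)"
              by (simp add: algebra_simps)
            also have "\<dots> \<le> \<sigma> / l * (\<Phi> v - \<Phi> u) + (k + \<eta>) * (v - u)"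
              using \<Phi>' by (simp add: \<eta>_eq)
            finally show ?thesis .
          qed simp
        qed
      qed (use d in simp)
    qed
    then show ?thesis using ab by (simp add: P_def)
  qed
  show ?thesis
  proof (rule field_le_epsilon)
    fix e :: real assume "0 < e"
    have "\<bar>F b - F a\<bar> \<le> \<sigma> / l * (\<Phi> b - \<Phi> a) + (k + e / (b - a + 1)) * (b - a)"
      using ab \<open>0 < e\<close> by (intro approx) simp
    also have "\<dots> = (\<sigma> / l * (\<Phi> b - \<Phi> a) + k * (b - a)) + e * ((b - a) / (b - a + 1))"
      by (simp add: distrib_right)
    also have "e * ((b - a) / (b - a + 1)) \<le> e"
      using ab \<open>0 < e\<close> by (intro mult_left_le) (simp_all add: divide_le_eq_1)
    finally show "\<bar>F b - F a\<bar> \<le> \<sigma> / l * (\<Phi> b - \<Phi> a) + k * (b - a) + e" by simp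
  qed
qed

section \<open>Quantitative convergence of the potentials\<close>

context interval_pair
begin

text \<open>The Hoelder constant: the first summand stems from the quadratic term of Young's inequality and the
  bound on the excess, the second one from the linear term.\<close>

definition rate :: real where
  "rate = 4096 * (L / l) / l * ((1 / l\<^sup>2 + 1) / ((l / L) ^ 3 / 4)) + 1 / 4"

lemma rate_pos: "0 < rate"
  unfolding rate_def using X.l_pos X.L_pos by (intro add_nonneg_pos) auto

end

definition qot_density :: "real \<Rightarrow> (real \<Rightarrow> real) \<Rightarrow> (real \<Rightarrow> real) \<Rightarrow> real \<times> real \<Rightarrow> real" where
  "qot_density \<epsilon> f g z = max ((fst z * snd z - f (fst z) - g (snd z)) / \<epsilon>) 0"

locale qot_pair = contact_pair +
  fixes \<epsilon> :: real and f g :: "real \<Rightarrow> real" and \<pi> :: "(real \<times> real) measure"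
  assumes \<epsilon>_pos: "0 < \<epsilon>"
    and continuous_f: "continuous_on UNIV f" and continuous_g: "continuous_on UNIV g"
    and plan: "is_qot_plan \<epsilon> \<mu>0 \<mu>1 \<pi>"
    and plan_density: "\<pi> = density \<mu>\<mu> (\<lambda>z. ennreal (qot_density \<epsilon> f g z))"
begin

abbreviation "\<rho> \<equiv> qot_density \<epsilon> f g"

lemma \<rho>_nonneg: "0 \<le> \<rho> z"
  by (simp add: qot_density_def)

lemma continuous_\<rho>: "continuous_on UNIV \<rho>"
  unfolding qot_density_def using \<epsilon>_pos
  by (intro continuous_intros continuous_on_compose2[OF continuous_f]
      continuous_on_compose2[OF continuous_g]) auto

lemma measurable_\<rho>: "\<rho> \<in> borel_measurable borel"
  by (rule borel_measurable_continuous_onI[OF continuous_\<rho>])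

lemma in_couplings: "\<pi> \<in> couplings \<mu>0 \<mu>1"
  using plan by (simp add: is_qot_plan_def)

lemmas marginal_integrals = coupling_marginals[OF in_couplings plan_density measurable_\<rho> \<rho>_nonneg]

lemma \<epsilon>_times_\<rho>: "\<epsilon> * \<rho> (x, y) = max (x * y - f x - g y) 0"
  using \<epsilon>_pos by (auto simp: qot_density_def max_def field_simps)

text \<open>The marginal conditions hold at every point and not only almost everywhere: testing the marginal
  against the continuous deviation \<open>\<phi>\<close> itself gives \<open>\<integral>\<phi>\<^sup>2 = 0\<close>.\<close>

lemma marginal_fst:
  assumes x: "x \<in> {a0..b0}"
  shows "(LINT y|\<mu>1. \<rho> (x, y)) = 1"
proof -
  define \<phi> where "\<phi> x = (LINT y|\<mu>1. \<rho> (x, y)) - 1" for x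
  have c\<phi>: "continuous_on UNIV \<phi>"
    unfolding \<phi>_def by (intro continuous_intros Y.continuous_parametric_integral continuous_\<rho>)
  have c: "continuous_on UNIV (\<lambda>z. \<rho> z * \<phi> (fst z))"
    by (intro continuous_intros continuous_\<rho> continuous_on_compose2[OF c\<phi>]) auto
  have "(LINT x|\<mu>0. \<phi> x) = (LINT z|\<mu>\<mu>. \<rho> z * \<phi> (fst z))"
    by (rule marginal_integrals(1)[OF c\<phi>, symmetric])
  also have "\<dots> = (LINT x|\<mu>0. LINT y|\<mu>1. \<rho> (x, y) * \<phi> x)"
    by (subst P.integral_fst'[OF integrable_pair[OF c], symmetric]) simp
  also have "\<dots> = (LINT x|\<mu>0. (\<phi> x)\<^sup>2 + \<phi> x)"
  proof (intro Bochner_Integration.integral_cong refl)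
    fix x
    have "(LINT y|\<mu>1. \<rho> (x, y)) = \<phi> x + 1" by (simp add: \<phi>_def)
    then show "(LINT y|\<mu>1. \<rho> (x, y) * \<phi> x) = (\<phi> x)\<^sup>2 + \<phi> x"
      by (simp add: power2_eq_square distrib_right)
  qed
  also have "\<dots> = (LINT x|\<mu>0. (\<phi> x)\<^sup>2) + (LINT x|\<mu>0. \<phi> x)"
    by (intro Bochner_Integration.integral_add X.integrable_continuous continuous_intros c\<phi>)
  finally have "(LINT x|\<mu>0. (\<phi> x)\<^sup>2) = 0" by simp
  then have "AE x in \<mu>0. (\<phi> x)\<^sup>2 = 0"
    using integral_nonneg_eq_0_iff_AE[of \<mu>0 "\<lambda>x. (\<phi> x)\<^sup>2"]
      X.integrable_continuous[OF continuous_on_power[OF c\<phi>]] by simp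
  then have "AE x in \<mu>0. \<phi> x = 0" by eventually_elim simp
  then have "\<phi> x = 0" by (rule X.AE_zero_imp_zero[OF c\<phi> _ x])
  then show ?thesis by (simp add: \<phi>_def)
qed

lemma marginal_snd:
  assumes y: "y \<in> {a1..b1}"
  shows "(LINT x|\<mu>0. \<rho> (x, y)) = 1"
proof -
  define \<phi> where "\<phi> y = (LINT x|\<mu>0. \<rho> (x, y)) - 1" for y
  have c\<rho>: "continuous_on UNIV (\<lambda>z. \<rho> (snd z, fst z))"
    by (rule continuous_on_compose2[OF continuous_\<rho>]) (auto intro!: continuous_intros)
  have c\<phi>: "continuous_on UNIV \<phi>"
    unfolding \<phi>_def
    using X.continuous_parametric_integral[OF c\<rho>] by (intro continuous_intros) simp
  have c: "continuous_on UNIV (\<lambda>z. \<rho> z * \<phi> (snd z))"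
    by (intro continuous_intros continuous_\<rho> continuous_on_compose2[OF c\<phi>]) auto
  have "(LINT y|\<mu>1. \<phi> y) = (LINT z|\<mu>\<mu>. \<rho> z * \<phi> (snd z))"
    by (rule marginal_integrals(2)[OF c\<phi>, symmetric])
  also have "\<dots> = (LINT y|\<mu>1. LINT x|\<mu>0. \<rho> (x, y) * \<phi> y)"
    using P.integral_snd[of "\<lambda>x y. \<rho> (x, y) * \<phi> y"] integrable_pair[OF c]
    by (simp add: case_prod_unfold)
  also have "\<dots> = (LINT y|\<mu>1. (\<phi> y)\<^sup>2 + \<phi> y)"
  proof (intro Bochner_Integration.integral_cong refl)
    fix y
    have "(LINT x|\<mu>0. \<rho> (x, y)) = \<phi> y + 1" by (simp add: \<phi>_def)
    then show "(LINT x|\<mu>0. \<rho> (x, y) * \<phi> y) = (\<phi> y)\<^sup>2 + \<phi> y"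
      by (simp add: power2_eq_square distrib_right)
  qed
  also have "\<dots> = (LINT y|\<mu>1. (\<phi> y)\<^sup>2) + (LINT y|\<mu>1. \<phi> y)"
    by (intro Bochner_Integration.integral_add Y.integrable_continuous continuous_intros c\<phi>)
  finally have "(LINT y|\<mu>1. (\<phi> y)\<^sup>2) = 0" by simp
  then have "AE y in \<mu>1. (\<phi> y)\<^sup>2 = 0"
    using integral_nonneg_eq_0_iff_AE[of \<mu>1 "\<lambda>y. (\<phi> y)\<^sup>2"]
      Y.integrable_continuous[OF continuous_on_power[OF c\<phi>]] by simp
  then have "AE y in \<mu>1. \<phi> y = 0" by eventually_elim simp
  then have "\<phi> y = 0" by (rule Y.AE_zero_imp_zero[OF c\<phi> _ y])
  then show ?thesis by (simp add: \<phi>_def)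
qed

lemma equation_fst: "x \<in> {a0..b0} \<Longrightarrow> (LINT y|\<mu>1. max (x * y - f x - g y) 0) = \<epsilon>"
  using marginal_fst[of x] by (simp flip: \<epsilon>_times_\<rho>)

lemma equation_snd: "y \<in> {a1..b1} \<Longrightarrow> (LINT x|\<mu>0. max (y * x - g y - f x) 0) = \<epsilon>"
proof -
  have "max (y * x - g y - f x) 0 = \<epsilon> * \<rho> (x, y)" for x
    by (simp add: \<epsilon>_times_\<rho> mult.commute diff_right_commute)
  then show "y \<in> {a1..b1} \<Longrightarrow> ?thesis" using marginal_snd[of y] by simp
qed

text \<open>The second moment of the conditional distribution given \<open>x\<close> about the point \<open>T x\<close>. By the quadratic
  growth of the gap its mean is controlled by the excess.\<close>

definition deviation :: "real \<Rightarrow> real" where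
  "deviation x = (LINT y|\<mu>1. (y - T x)\<^sup>2 * \<rho> (x, y))"

lemma continuous_deviation_integrand: "continuous_on UNIV (\<lambda>z. (snd z - T (fst z))\<^sup>2 * \<rho> z)"
  by (intro continuous_intros continuous_\<rho> continuous_on_compose2[OF continuous_T]) auto

lemma continuous_deviation: "continuous_on UNIV deviation"
  unfolding deviation_def
  using Y.continuous_parametric_integral[OF continuous_deviation_integrand] by simp

lemma deviation_nonneg: "0 \<le> deviation x"
  unfolding deviation_def by (intro Bochner_Integration.integral_nonneg) (simp add: \<rho>_nonneg)

lemma integral_deviation: "(l / L) ^ 3 / 4 * (LINT x|\<mu>0. deviation x) \<le> excess \<epsilon> \<rho>"
proof -
  note c = continuous_deviation_integrand
  have "(LINT x|\<mu>0. deviation x) = (LINT z|\<mu>\<mu>. (snd z - T (fst z))\<^sup>2 * \<rho> z)"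
    unfolding deviation_def
    by (subst P.integral_fst'[OF integrable_pair[OF c], symmetric]) simp
  then have "(l / L) ^ 3 / 4 * (LINT x|\<mu>0. deviation x) =
      (LINT z|\<mu>\<mu>. (l / L) ^ 3 / 4 * ((snd z - T (fst z))\<^sup>2 * \<rho> z))"
    by (simp only: integral_mult_right_zero)
  also have "\<dots> \<le> (LINT z|\<mu>\<mu>. \<rho> z * Gap z)"
  proof (rule integral_mono_AE)
    show "integrable \<mu>\<mu> (\<lambda>z. (l / L) ^ 3 / 4 * ((snd z - T (fst z))\<^sup>2 * \<rho> z))"
      by (intro integrable_pair continuous_on_mult continuous_on_const c)
    show "integrable \<mu>\<mu> (\<lambda>z. \<rho> z * Gap z)"
      by (intro integrable_pair continuous_on_mult continuous_\<rho> continuous_Gap)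
    show "AE z in \<mu>\<mu>. (l / L) ^ 3 / 4 * ((snd z - T (fst z))\<^sup>2 * \<rho> z) \<le> \<rho> z * Gap z"
      using AE_rectangle
    proof eventually_elim
      case (elim z)
      then have "\<rho> z * ((l / L) ^ 3 / 4 * (snd z - T (fst z))\<^sup>2) \<le> \<rho> z * Gap z"
        by (intro mult_left_mono gap_lower \<rho>_nonneg) auto
      then show ?case by (simp only: mult_ac)
    qed
  qed
  also have "\<dots> \<le> excess \<epsilon> \<rho>"
    unfolding excess_def using \<epsilon>_pos by (simp add: Bochner_Integration.integral_nonneg)
  finally show ?thesis .
qed

text \<open>The equation in the second variable makes \<open>g\<close> convex, so the sections in the first variable are
  intervals carrying a concave density, and the bound on second moments applies to them.\<close>

lemma subgradient_near_T:
  assumes x: "x \<in> {a0..b0}"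
  obtains p where "\<And>z. z \<in> {a0..b0} \<Longrightarrow> f x + p * (z - x) \<le> f z"
    and "(p - T x)\<^sup>2 \<le> 4096 * (L / l) * deviation x"
proof -
  let ?\<psi> = "\<lambda>y. x * y - f x - g y"
  have conv: "convex_on {a1..b1} g"
    by (rule X.potential_convex[OF continuous_f \<epsilon>_pos _ equation_snd]) auto
  have conc: "(1 - t) * ?\<psi> u + t * ?\<psi> v \<le> ?\<psi> ((1 - t) * u + t * v)"
    if "0 \<le> t" "t \<le> 1" "u \<in> {a1..b1}" "v \<in> {a1..b1}" for t u v
    using convex_onD[OF conv that] by (simp add: algebra_simps)
  have c\<psi>: "continuous_on UNIV ?\<psi>" by (intro continuous_intros continuous_g)
  have pos: "0 < (LINT y|\<mu>1. max (?\<psi> y) 0)" using equation_fst[OF x] \<epsilon>_pos by simp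
  obtain \<alpha> \<beta> where sec: "\<And>y. y \<in> {a1..b1} \<Longrightarrow> 0 < ?\<psi> y \<Longrightarrow> y \<in> {\<alpha>..\<beta>}"
    and bnd: "\<And>p. p \<in> {\<alpha>..\<beta>} \<Longrightarrow> (p - T x)\<^sup>2 * (LINT y|\<mu>1. max (?\<psi> y) 0)
        \<le> 4096 * (L / l) * (LINT y|\<mu>1. (y - T x)\<^sup>2 * max (?\<psi> y) 0)"
    using Y.section_second_moment[OF c\<psi> conc pos, where \<tau> = "T x"] by blast
  obtain p where p: "p \<in> {\<alpha>..\<beta>}" "\<And>z. z \<in> {a0..b0} \<Longrightarrow> f x + p * (z - x) \<le> f z"
    using Y.potential_subgradient[OF continuous_g \<epsilon>_pos equation_fst x sec] by blast
  have "(LINT y|\<mu>1. (y - T x)\<^sup>2 * max (?\<psi> y) 0) = \<epsilon> * deviation x"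
    unfolding deviation_def by (simp add: mult.left_commute flip: \<epsilon>_times_\<rho>)
  then have "\<epsilon> * (p - T x)\<^sup>2 \<le> \<epsilon> * (4096 * (L / l) * deviation x)"
    using bnd[OF p(1)] equation_fst[OF x] by (simp add: mult_ac)
  then have "(p - T x)\<^sup>2 \<le> 4096 * (L / l) * deviation x"
    using \<epsilon>_pos by (simp only: mult_le_cancel_left_pos)
  with p(2) show ?thesis by (rule that)
qed

text \<open>The free parameter \<open>\<tau>\<close> weighs the two terms of Young's inequality
  \<open>\<bar>p - T x\<bar> \<le> \<tau> (p - T x)\<^sup>2 + 1 / (4 \<tau>)\<close>; optimizing it later has the same effect as the
  Cauchy--Schwarz inequality. The squares are integrated over \<open>{x..z}\<close> through the distribution function
  \<open>\<Phi>\<close> of the deviation.\<close>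

lemma potential_increment:
  assumes xz: "x \<in> {a0..b0}" "z \<in> {a0..b0}" "x \<le> z" and \<tau>: "0 < \<tau>"
  shows "\<bar>(f z - f0 z) - (f x - f0 x)\<bar>
    \<le> \<tau> * (4096 * (L / l)) / l * (LINT x|\<mu>0. deviation x) + 1 / (4 * \<tau>) * (z - x)"
proof -
  define \<sigma> where "\<sigma> = \<tau> * (4096 * (L / l))"
  have \<sigma>: "0 \<le> \<sigma>" using \<tau> X.l_pos X.L_pos by (simp add: \<sigma>_def)
  define \<Phi> where "\<Phi> v = (LINT s|\<mu>0. indicat_real {..v} s * deviation s)" for v
  have int_dev: "integrable \<mu>0 (\<lambda>s. indicat_real A s * deviation s)" if "A \<in> sets borel" for A
    using integrable_mult_indicator[OF _ X.integrable_continuous[OF continuous_deviation], of A] that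
    by simp
  have \<Phi>_diff: "\<Phi> v - \<Phi> u = (LINT s|\<mu>0. indicat_real {u<..v} s * deviation s)" if "u \<le> v" for u v
  proof -
    have "(LINT s|\<mu>0. indicat_real {..v} s * deviation s - indicat_real {..u} s * deviation s) =
        (LINT s|\<mu>0. indicat_real {u<..v} s * deviation s)"
      by (intro Bochner_Integration.integral_cong refl) (use that in \<open>auto simp: indicator_def\<close>)
    then show ?thesis unfolding \<Phi>_def using int_dev by simp
  qed
  have \<Phi>_lower: "l * c * (v - u) \<le> \<Phi> v - \<Phi> u"
    if uv: "x \<le> u" "u \<le> v" "v \<le> z" and c: "\<And>s. s \<in> {u..v} \<Longrightarrow> c \<le> deviation s" for u v c
  proof (cases "0 \<le> c")
    case True
    have "l * c * (v - u) \<le> c * measure \<mu>0 {u<..v}"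
      using X.mass_lower[of u v] uv xz mult_left_mono[OF _ True, of "l * (v - u)" "measure \<mu>0 {u<..v}"]
      by (simp add: X.mass_half_open mult_ac)
    also have "\<dots> = (LINT s|\<mu>0. indicat_real {u<..v} s * c)" by simp
    also have "\<dots> \<le> (LINT s|\<mu>0. indicat_real {u<..v} s * deviation s)"
    proof (rule integral_mono)
      show "integrable \<mu>0 (\<lambda>s. indicat_real {u<..v} s * c)" by (simp add: X.integrable_indicat)
      show "integrable \<mu>0 (\<lambda>s. indicat_real {u<..v} s * deviation s)" by (rule int_dev) simp
    qed (use c in \<open>auto simp: indicator_def\<close>)
    finally show ?thesis by (simp only: \<Phi>_diff[OF uv(2)])
  next
    case False
    then have "l * c * (v - u) \<le> 0" using X.l_pos uv by (simp add: mult_nonneg_nonpos mult_nonpos_nonneg)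
    also have "0 \<le> \<Phi> v - \<Phi> u"
      unfolding \<Phi>_diff[OF uv(2)]
      by (intro Bochner_Integration.integral_nonneg) (simp add: deviation_nonneg)
    finally show ?thesis .
  qed
  have young: "\<bar>p\<bar> \<le> \<tau> * p\<^sup>2 + 1 / (4 * \<tau>)" for p :: real
  proof -
    have "0 \<le> (2 * \<tau> * \<bar>p\<bar> - 1)\<^sup>2 / (4 * \<tau>)" using \<tau> by simp
    also have "\<dots> = \<tau> * p\<^sup>2 - \<bar>p\<bar> + 1 / (4 * \<tau>)"
      using \<tau> by (simp add: power2_diff power_mult_distrib diff_divide_distrib add_divide_distrib)
        (simp add: power2_eq_square)
    finally show ?thesis by simp
  qed
  have slope: "\<bar>p - T s\<bar> \<le> \<sigma> * deviation s + 1 / (4 * \<tau>)"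
    if "(p - T s)\<^sup>2 \<le> 4096 * (L / l) * deviation s" for p s
  proof -
    have "\<tau> * (p - T s)\<^sup>2 \<le> \<sigma> * deviation s"
      using mult_left_mono[OF that, of \<tau>] \<tau> by (simp add: \<sigma>_def mult_ac)
    then show ?thesis using young[of "p - T s"] by linarith
  qed
  have incr: "\<bar>(f v - f0 v) - (f u - f0 u)\<bar>
      \<le> (\<sigma> * max (deviation u) (deviation v) + 1 / (4 * \<tau>) + (T v - T u)) * (v - u)"
    if uv: "x \<le> u" "u < v" "v \<le> z" for u v
  proof -
    have I: "u \<in> {a0..b0}" "v \<in> {a0..b0}" using uv xz by auto
    obtain p where p: "\<And>w. w \<in> {a0..b0} \<Longrightarrow> f u + p * (w - u) \<le> f w"
      "(p - T u)\<^sup>2 \<le> 4096 * (L / l) * deviation u" using subgradient_near_T[OF I(1)] by blast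
    obtain q where q: "\<And>w. w \<in> {a0..b0} \<Longrightarrow> f v + q * (w - v) \<le> f w"
      "(q - T v)\<^sup>2 \<le> 4096 * (L / l) * deviation v" using subgradient_near_T[OF I(2)] by blast
    define M where "M = \<sigma> * max (deviation u) (deviation v) + 1 / (4 * \<tau>) + (T v - T u)"
    have "\<sigma> * deviation u \<le> \<sigma> * max (deviation u) (deviation v)"
      "\<sigma> * deviation v \<le> \<sigma> * max (deviation u) (deviation v)"
      using \<sigma> by (auto intro: mult_left_mono)
    then have le: "q - T u \<le> M" "T v - p \<le> M"
      using slope[OF p(2)] slope[OF q(2)] by (auto simp: M_def)
    have "(f v - f0 v) - (f u - f0 u) \<le> (q - T u) * (v - u)"
      using q(1)[OF I(1)] f0_subgradient[OF I(2,1)] by (simp add: algebra_simps)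
    also have "\<dots> \<le> M * (v - u)" using le uv by (intro mult_right_mono) auto
    finally have up: "(f v - f0 v) - (f u - f0 u) \<le> M * (v - u)" .
    have "(f u - f0 u) - (f v - f0 v) \<le> (T v - p) * (v - u)"
      using p(1)[OF I(2)] f0_subgradient[OF I] by (simp add: algebra_simps)
    also have "\<dots> \<le> M * (v - u)" using le uv by (intro mult_right_mono) auto
    finally have "(f u - f0 u) - (f v - f0 v) \<le> M * (v - u)" .
    with up show ?thesis unfolding M_def[symmetric] by linarith
  qed
  have "\<bar>(f z - f0 z) - (f x - f0 x)\<bar> \<le> \<sigma> / l * (\<Phi> z - \<Phi> x) + 1 / (4 * \<tau>) * (z - x)"
    by (rule increment_bound[OF xz(3) X.l_pos \<sigma> continuous_deviation continuous_T[of UNIV] \<Phi>_lower incr])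
  moreover have "\<Phi> z - \<Phi> x \<le> (LINT s|\<mu>0. deviation s)"
    unfolding \<Phi>_diff[OF xz(3)]
  proof (rule integral_mono)
    show "integrable \<mu>0 (\<lambda>s. indicat_real {x<..z} s * deviation s)" by (rule int_dev) simp
    show "integrable \<mu>0 deviation" by (rule X.integrable_continuous[OF continuous_deviation])
  qed (simp add: indicator_def deviation_nonneg)
  then have "\<sigma> / l * (\<Phi> z - \<Phi> x) \<le> \<sigma> / l * (LINT s|\<mu>0. deviation s)"
    using \<sigma> X.l_pos by (intro mult_left_mono) auto
  ultimately show ?thesis unfolding \<sigma>_def by linarith
qed

text \<open>The total mass of both potentials falls short of the unregularized one by the integral of the
  gap plus twice the regularization term.\<close>

lemma potential_mean:
  assumes "(LINT x|\<mu>0. f x) = (LINT y|\<mu>1. g y)" "(LINT x|\<mu>0. f0 x) = (LINT y|\<mu>1. g0 y)"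
  shows "\<bar>LINT x|\<mu>0. f x - f0 x\<bar> \<le> excess \<epsilon> \<rho>"
proof -
  let ?Q = "LINT z|\<mu>\<mu>. (\<rho> z)\<^sup>2" and ?G = "LINT z|\<mu>\<mu>. \<rho> z * Gap z"
  have cfst: "continuous_on UNIV (\<lambda>z :: real \<times> real. h (fst z))"
    and csnd: "continuous_on UNIV (\<lambda>z :: real \<times> real. h (snd z))"
    if "continuous_on UNIV h" for h :: "real \<Rightarrow> real"
    by (rule continuous_on_compose2[OF that]; auto intro!: continuous_intros)+
  have int: "integrable \<mu>\<mu> (\<lambda>z. \<rho> z * H z)" if "continuous_on UNIV H" for H
    by (intro integrable_pair continuous_on_mult continuous_\<rho> that)
  have "\<epsilon> * (\<rho> z)\<^sup>2 + \<rho> z * Gap z = (\<rho> z * f0 (fst z) + \<rho> z * g0 (snd z)) -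
      (\<rho> z * f (fst z) + \<rho> z * g (snd z))" for z
  proof -
    have "\<epsilon> * (\<rho> z)\<^sup>2 = \<rho> z * (fst z * snd z - f (fst z) - g (snd z))"
      using \<epsilon>_pos by (auto simp: qot_density_def max_def power2_eq_square)
    then show ?thesis by (simp add: gap_def algebra_simps)
  qed
  then have "(LINT z|\<mu>\<mu>. \<epsilon> * (\<rho> z)\<^sup>2 + \<rho> z * Gap z) =
      (LINT z|\<mu>\<mu>. (\<rho> z * f0 (fst z) + \<rho> z * g0 (snd z)) - (\<rho> z * f (fst z) + \<rho> z * g (snd z)))"
    by simp
  also have "\<dots> = ((LINT x|\<mu>0. f0 x) + (LINT y|\<mu>1. g0 y)) - ((LINT x|\<mu>0. f x) + (LINT y|\<mu>1. g y))"
    using marginal_integrals(1)[OF continuous_f0] marginal_integrals(2)[OF continuous_g0]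
      marginal_integrals(1)[OF continuous_f] marginal_integrals(2)[OF continuous_g]
      int[OF cfst[OF continuous_f0]] int[OF csnd[OF continuous_g0]]
      int[OF cfst[OF continuous_f]] int[OF csnd[OF continuous_g]] by simp
  also have "(LINT z|\<mu>\<mu>. \<epsilon> * (\<rho> z)\<^sup>2 + \<rho> z * Gap z) = \<epsilon> * ?Q + ?G"
    using int[OF continuous_Gap] int[OF continuous_\<rho>] by (simp add: power2_eq_square)
  finally have eq: "\<epsilon> * ?Q + ?G = 2 * (LINT x|\<mu>0. f0 x) - 2 * (LINT x|\<mu>0. f x)"
    using assms by simp
  have diff: "(LINT x|\<mu>0. f x - f0 x) = (LINT x|\<mu>0. f x) - (LINT x|\<mu>0. f0 x)"
    by (intro Bochner_Integration.integral_diff X.integrable_continuous continuous_f continuous_f0)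
  have "0 \<le> \<epsilon> * ?Q" using \<epsilon>_pos by (simp add: Bochner_Integration.integral_nonneg)
  moreover have "0 \<le> ?G"
  proof (rule integral_nonneg_AE)
    show "AE z in \<mu>\<mu>. 0 \<le> \<rho> z * Gap z"
      using AE_rectangle by eventually_elim (simp add: \<rho>_nonneg gap_nonneg)
  qed
  ultimately show ?thesis using eq unfolding diff excess_def by simp
qed

text \<open>The number of blocks is taken of order \<open>\<epsilon> powr (- 1 / 3)\<close>, where the two terms of the competitor's
  excess balance.\<close>

lemma excess_le:
  assumes "\<epsilon> < 1"
  shows "excess \<epsilon> \<rho> \<le> (1 / l\<^sup>2 + 1) * \<epsilon> powr (2 / 3)"
proof -
  define r where "r = \<epsilon> powr (1 / 3)"
  have r: "0 < r" "r \<le> 1" using \<epsilon>_pos assms by (auto simp: r_def powr_le1)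
  have r3: "r ^ 3 = \<epsilon>" and r2: "r\<^sup>2 = \<epsilon> powr (2 / 3)"
    using \<epsilon>_pos by (simp_all add: r_def powr_powr flip: powr_numeral)
  define N where "N = nat \<lceil>1 / r\<rceil>"
  have "1 \<le> 1 / r" using r by simp
  then have N: "0 < N" "1 / r \<le> real N" "real N \<le> 2 / r" unfolding N_def by linarith+
  obtain B where B: "AE z in \<mu>\<mu>. \<bar>\<rho> z\<bar> \<le> B" using AE_bounded[OF continuous_\<rho>] by blast
  have "excess \<epsilon> \<rho> \<le> 1 / (l * real N)\<^sup>2 + \<epsilon> / 2 * real N"
    by (rule excess_plan_le[OF plan plan_density measurable_\<rho> \<rho>_nonneg B _ N(1)]) (use \<epsilon>_pos in simp)
  also have "1 / (l * real N)\<^sup>2 \<le> 1 / (l / r)\<^sup>2"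
  proof (rule divide_left_mono)
    have "l / r \<le> l * real N" using mult_left_mono[OF N(2), of l] X.l_pos by simp
    then show "(l / r)\<^sup>2 \<le> (l * real N)\<^sup>2" using r X.l_pos by (intro power_mono) auto
  qed (use r X.l_pos N in auto)
  also have "\<dots> = 1 / l\<^sup>2 * r\<^sup>2" by (simp add: power_divide)
  also have "\<epsilon> / 2 * real N \<le> \<epsilon> / 2 * (2 / r)" using N \<epsilon>_pos by (intro mult_left_mono) auto
  also have "\<dots> = r\<^sup>2" using r by (simp flip: r3 add: power2_eq_square power3_eq_cube)
  finally show ?thesis by (simp add: r2 distrib_right)
qed

text \<open>Young's parameter is taken to be \<open>\<tau> = sqrt (z - x) / \<epsilon> powr (1 / 3)\<close>, which gives both terms of
  the increment bound the same order.\<close>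

lemma potential_holder:
  assumes "\<epsilon> < 1" and x: "x \<in> {a0..b0}" and z: "z \<in> {a0..b0}"
  shows "\<bar>(f x - f0 x) - (f z - f0 z)\<bar> \<le> rate * sqrt \<bar>x - z\<bar> * \<epsilon> powr (1 / 3)"
proof -
  define r where "r = \<epsilon> powr (1 / 3)"
  have r: "0 < r" using \<epsilon>_pos by (simp add: r_def)
  have r2: "\<epsilon> powr (2 / 3) = r\<^sup>2" using \<epsilon>_pos by (simp add: r_def powr_powr flip: powr_numeral)
  define c where "c = 4096 * (L / l) / l"
  define \<kappa> where "\<kappa> = (l / L) ^ 3 / 4"
  define K where "K = 1 / l\<^sup>2 + 1"
  have pos: "0 < c" "0 < \<kappa>" using X.l_pos X.L_pos by (auto simp: c_def \<kappa>_def)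
  have "\<kappa> * (LINT x|\<mu>0. deviation x) \<le> K * r\<^sup>2"
    unfolding \<kappa>_def K_def r2[symmetric]
    by (rule order_trans[OF integral_deviation excess_le[OF assms(1)]])
  then have dev: "(LINT x|\<mu>0. deviation x) \<le> K / \<kappa> * r\<^sup>2"
    using pos by (simp add: pos_le_divide_eq mult.commute)
  have main: "\<bar>(f v - f0 v) - (f u - f0 u)\<bar> \<le> rate * sqrt (v - u) * r"
    if uv: "u \<in> {a0..b0}" "v \<in> {a0..b0}" "u < v" for u v
  proof -
    define q where "q = sqrt (v - u)"
    have q: "0 < q" "v - u = q * q" using uv by (simp_all add: q_def)
    have "\<bar>(f v - f0 v) - (f u - f0 u)\<bar>
        \<le> (q / r) * (4096 * (L / l)) / l * (LINT x|\<mu>0. deviation x) + 1 / (4 * (q / r)) * (v - u)"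
      by (rule potential_increment) (use uv q r in auto)
    also have "(q / r) * (4096 * (L / l)) / l * (LINT x|\<mu>0. deviation x) =
        (q / r) * c * (LINT x|\<mu>0. deviation x)" by (simp add: c_def)
    also have "\<dots> \<le> (q / r) * c * (K / \<kappa> * r\<^sup>2)"
      using dev q r pos by (intro mult_left_mono) auto
    also have "\<dots> = c * (K / \<kappa>) * q * r" using r by (simp add: power2_eq_square)
    also have "1 / (4 * (q / r)) * (v - u) = 1 / 4 * q * r" using q r by simp
    also have "c * (K / \<kappa>) * q * r + 1 / 4 * q * r = rate * q * r"
      unfolding rate_def c_def K_def \<kappa>_def by (simp only: distrib_right)
    finally show ?thesis by (simp add: q_def)
  qed
  consider "x < z" | "x = z" | "z < x" by linarith
  then show ?thesis
    using main[of x z] main[of z x] x z by cases (simp_all add: r_def abs_minus_commute)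
qed

lemma potential_sup:
  assumes "\<epsilon> < 1" and x: "x \<in> {a0..b0}"
    and "(LINT x|\<mu>0. f x) = (LINT y|\<mu>1. g y)" "(LINT x|\<mu>0. f0 x) = (LINT y|\<mu>1. g0 y)"
  shows "\<bar>f x - f0 x\<bar> \<le> (1 / l\<^sup>2 + 1 + rate * sqrt (b0 - a0)) * \<epsilon> powr (1 / 3)"
proof -
  define r where "r = \<epsilon> powr (1 / 3)"
  define D where "D = rate * sqrt (b0 - a0) * r"
  have "0 < r" using \<epsilon>_pos by (simp add: r_def)
  have int: "integrable \<mu>0 (\<lambda>y. f y - f0 y)"
    by (intro X.integrable_continuous continuous_intros continuous_f continuous_f0)
  have "\<epsilon> powr (2 / 3) \<le> \<epsilon> powr (1 / 3)"
    using \<epsilon>_pos assms(1) by (intro powr_mono') auto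
  then have "(1 / l\<^sup>2 + 1) * \<epsilon> powr (2 / 3) \<le> (1 / l\<^sup>2 + 1) * r"
    unfolding r_def by (intro mult_left_mono) auto
  then have mean: "\<bar>LINT y|\<mu>0. f y - f0 y\<bar> \<le> (1 / l\<^sup>2 + 1) * r"
    using potential_mean[OF assms(3,4)] excess_le[OF assms(1)] by linarith
  have osc: "\<bar>(f x - f0 x) - (f y - f0 y)\<bar> \<le> D" if "y \<in> {a0..b0}" for y
  proof -
    have "\<bar>(f x - f0 x) - (f y - f0 y)\<bar> \<le> rate * sqrt \<bar>x - y\<bar> * r"
      using potential_holder[OF assms(1) x that] by (simp add: r_def)
    also have "\<dots> \<le> D"
      unfolding D_def using x that rate_pos \<open>0 < r\<close>
      by (intro mult_right_mono mult_left_mono real_sqrt_le_mono) auto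
    finally show ?thesis .
  qed
  have "\<bar>LINT y|\<mu>0. (f x - f0 x) - (f y - f0 y)\<bar>
      \<le> (LINT y|\<mu>0. \<bar>(f x - f0 x) - (f y - f0 y)\<bar>)" by (rule integral_abs_bound)
  also have "\<dots> \<le> (LINT y|\<mu>0. D)"
  proof (rule integral_mono_AE)
    show "AE y in \<mu>0. \<bar>(f x - f0 x) - (f y - f0 y)\<bar> \<le> D"
      using X.AE_interval by eventually_elim (rule osc)
  qed (use int in auto)
  also have "(LINT y|\<mu>0. D) = D" using X.prob_space by simp
  also have "(LINT y|\<mu>0. (f x - f0 x) - (f y - f0 y)) = (f x - f0 x) - (LINT y|\<mu>0. f y - f0 y)"
    using int X.prob_space by (subst Bochner_Integration.integral_diff) simp_all
  finally have "\<bar>f x - f0 x\<bar> \<le> (1 / l\<^sup>2 + 1) * r + D" using mean by linarith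
  then show ?thesis by (simp add: D_def r_def distrib_right)
qed

end

lemma holder_norm_half_le:
  assumes "0 \<le> B1" "0 \<le> B2"
    and "\<And>x. x \<in> S \<Longrightarrow> \<bar>h x\<bar> \<le> B1"
    and "\<And>x y. x \<in> S \<Longrightarrow> y \<in> S \<Longrightarrow> \<bar>h x - h y\<bar> \<le> B2 * sqrt \<bar>x - y\<bar>"
  shows "holder_norm (1 / 2) S h \<le> ennreal (B1 + B2)"
proof -
  have "(SUP x\<in>S. ennreal \<bar>h x\<bar>) \<le> ennreal B1"
    by (intro SUP_least ennreal_leI assms)
  moreover have "(SUP (x, y)\<in>{(x, y). x \<in> S \<and> y \<in> S \<and> x \<noteq> y}.
      ennreal (\<bar>h x - h y\<bar> / \<bar>x - y\<bar> powr (1 / 2))) \<le> ennreal B2"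
  proof (intro SUP_least, clarify)
    fix x y assume xy: "x \<in> S" "y \<in> S" "x \<noteq> y"
    then have "\<bar>h x - h y\<bar> / \<bar>x - y\<bar> powr (1 / 2) \<le> B2"
      using assms(4)[OF xy(1,2)] by (simp add: powr_half_sqrt pos_divide_le_eq)
    then show "ennreal (\<bar>h x - h y\<bar> / \<bar>x - y\<bar> powr (1 / 2)) \<le> ennreal B2" by (rule ennreal_leI)
  qed
  ultimately show ?thesis
    unfolding holder_norm_def using assms(1,2) by (simp add: ennreal_plus add_mono)
qed

text \<open>Potentials are only controlled on the two intervals. Extending them by their boundary values
  makes them continuous on the line and changes neither the plan nor the integrals.\<close>

theorem corollary2p7:
  fixes \<mu>0 \<mu>1 :: "real measure"
    and u0 u1 :: "real \<Rightarrow> real"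
    and a0 b0 a1 b1 l L :: real
    and f g :: "real \<Rightarrow> real \<Rightarrow> real"
    and f0 g0 :: "real \<Rightarrow> real"
  assumes "has_bounded_continuous_density l L a0 b0 u0 \<mu>0"
    and "has_bounded_continuous_density l L a1 b1 u1 \<mu>1"
    and "\<And>\<epsilon>. 0 < \<epsilon> \<Longrightarrow> qot_potentials \<epsilon> {a0..b0} {a1..b1} \<mu>0 \<mu>1 (f \<epsilon>) (g \<epsilon>)"
    and "\<And>\<epsilon>. 0 < \<epsilon> \<Longrightarrow> (LINT x:{a0..b0}|\<mu>0. f \<epsilon> x) = (LINT y:{a1..b1}|\<mu>1. g \<epsilon> y)"
    and "kantorovich_potentials {a0..b0} {a1..b1} \<mu>0 \<mu>1 f0 g0"
    and "(LINT x:{a0..b0}|\<mu>0. f0 x) = (LINT y:{a1..b1}|\<mu>1. g0 y)"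
  shows "\<exists>C>0. \<exists>\<epsilon>0>0. \<forall>\<epsilon>. 0 < \<epsilon> \<and> \<epsilon> < \<epsilon>0 \<longrightarrow>
           holder_norm (1 / 2) {a0..b0} (\<lambda>x. f \<epsilon> x - f0 x) \<le> ennreal (C * \<epsilon> powr (1 / 3))"
proof -
  interpret X: interval_measure \<mu>0 a0 b0 l L
    by (rule has_bounded_continuous_density_imp_interval_measure[OF assms(1)])
  interpret Y: interval_measure \<mu>1 a1 b1 l L
    by (rule has_bounded_continuous_density_imp_interval_measure[OF assms(2)])
  interpret XY: interval_pair \<mu>0 \<mu>1 a0 b0 a1 b1 l L ..
  define clamp0 where "clamp0 h x = h (max a0 (min b0 x))" for h :: "real \<Rightarrow> real" and x
  define clamp1 where "clamp1 h x = h (max a1 (min b1 x))" for h :: "real \<Rightarrow> real" and x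
  have clamp_eq: "x \<in> {a0..b0} \<Longrightarrow> clamp0 h x = h x" "x \<in> {a1..b1} \<Longrightarrow> clamp1 h x = h x" for h x
    by (simp_all add: clamp0_def clamp1_def)
  have clamp0_cont: "continuous_on UNIV (clamp0 h)" if "continuous_on {a0..b0} h" for h
    unfolding clamp0_def using continuous_on_clamp[OF that] X.a_less_b by simp
  have clamp1_cont: "continuous_on UNIV (clamp1 h)" if "continuous_on {a1..b1} h" for h
    unfolding clamp1_def using continuous_on_clamp[OF that] Y.a_less_b by simp
  have int0: "(LINT x:{a0..b0}|\<mu>0. h x) = (LINT x|\<mu>0. clamp0 h x)" if "continuous_on {a0..b0} h" for h
    using X.set_integral_interval[OF clamp0_cont[OF that, unfolded clamp0_def]]
    by (simp add: clamp0_def)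
  have int1: "(LINT x:{a1..b1}|\<mu>1. h x) = (LINT x|\<mu>1. clamp1 h x)" if "continuous_on {a1..b1} h" for h
    using Y.set_integral_interval[OF clamp1_cont[OF that, unfolded clamp1_def]]
    by (simp add: clamp1_def)
  note cont0 = XY.kantorovich_continuous[OF assms(5)]
  interpret C: contact_pair \<mu>0 \<mu>1 a0 b0 a1 b1 l L "clamp0 f0" "clamp1 g0"
  proof
    show "continuous_on UNIV (clamp0 f0)" by (rule clamp0_cont[OF cont0(1)])
    show "continuous_on UNIV (clamp1 g0)" by (rule clamp1_cont[OF cont0(2)])
    show "x * y \<le> clamp0 f0 x + clamp1 g0 y" if "x \<in> {a0..b0}" "y \<in> {a1..b1}" for x y
    proof -
      have "dual_admissible {a0..b0} {a1..b1} \<mu>0 \<mu>1 f0 g0"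
        using assms(5) unfolding kantorovich_potentials_def by blast
      then show ?thesis using that by (simp add: clamp_eq dual_admissible_def)
    qed
    show "clamp0 f0 x + clamp1 g0 (XY.T x) = x * XY.T x" if "x \<in> {a0..b0}" for x
      using XY.kantorovich_contact[OF assms(5) that] that XY.T_mem by (simp only: clamp_eq)
  qed
  define K where "K = 1 / l\<^sup>2 + 1 + XY.rate * sqrt (b0 - a0)"
  have K: "0 < K" using X.a_less_b XY.rate_pos by (auto simp: K_def intro!: add_pos_nonneg add_nonneg_pos)
  have bound: "holder_norm (1 / 2) {a0..b0} (\<lambda>x. f \<epsilon> x - f0 x) \<le> ennreal ((K + XY.rate) * \<epsilon> powr (1 / 3))"
    if \<epsilon>: "0 < \<epsilon>" "\<epsilon> < 1" for \<epsilon>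
  proof -
    obtain \<pi> where cf: "continuous_on {a0..b0} (f \<epsilon>)" and cg: "continuous_on {a1..b1} (g \<epsilon>)"
      and plan: "is_qot_plan \<epsilon> \<mu>0 \<mu>1 \<pi>" and ac: "absolutely_continuous XY.\<mu>\<mu> \<pi>"
      and dens: "AE z in XY.\<mu>\<mu>. RN_deriv XY.\<mu>\<mu> \<pi> z =
         ennreal (max ((fst z * snd z - f \<epsilon> (fst z) - g \<epsilon> (snd z)) / \<epsilon>) 0)"
      using assms(3)[OF \<epsilon>(1)] by (auto simp: qot_potentials_def)
    interpret Q: qot_pair \<mu>0 \<mu>1 a0 b0 a1 b1 l L "clamp0 f0" "clamp1 g0" \<epsilon>
      "clamp0 (f \<epsilon>)" "clamp1 (g \<epsilon>)" \<pi>
    proof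
      have c\<rho>: "continuous_on UNIV (qot_density \<epsilon> (clamp0 (f \<epsilon>)) (clamp1 (g \<epsilon>)))"
        unfolding qot_density_def using \<epsilon>
        by (intro continuous_intros continuous_on_compose2[OF clamp0_cont[OF cf]]
            continuous_on_compose2[OF clamp1_cont[OF cg]]) auto
      have "sets \<pi> = sets borel" using plan by (simp add: is_qot_plan_def couplings_def)
      then have "sets \<pi> = sets XY.\<mu>\<mu>" by (simp only: XY.sets_pair)
      then have "\<pi> = density XY.\<mu>\<mu> (RN_deriv XY.\<mu>\<mu> \<pi>)"
        using XY.P.density_RN_deriv[OF ac] by simp
      also have "\<dots> = density XY.\<mu>\<mu> (\<lambda>z. ennreal (qot_density \<epsilon> (clamp0 (f \<epsilon>)) (clamp1 (g \<epsilon>)) z))"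
      proof (rule density_cong)
        show "AE z in XY.\<mu>\<mu>. RN_deriv XY.\<mu>\<mu> \<pi> z =
            ennreal (qot_density \<epsilon> (clamp0 (f \<epsilon>)) (clamp1 (g \<epsilon>)) z)"
          using dens XY.AE_rectangle
          by eventually_elim (simp only: qot_density_def clamp_eq)
        show "(\<lambda>z. ennreal (qot_density \<epsilon> (clamp0 (f \<epsilon>)) (clamp1 (g \<epsilon>)) z)) \<in> borel_measurable XY.\<mu>\<mu>"
          using borel_measurable_continuous_onI[OF c\<rho>] by (simp add: XY.measurable_pair_eq)
      qed simp
      finally show "\<pi> = density XY.\<mu>\<mu> (\<lambda>z. ennreal (qot_density \<epsilon> (clamp0 (f \<epsilon>)) (clamp1 (g \<epsilon>)) z))" .
    qed (use \<epsilon> plan clamp0_cont[OF cf] clamp1_cont[OF cg] in simp_all)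
    have "holder_norm (1 / 2) {a0..b0} (\<lambda>x. f \<epsilon> x - f0 x)
        \<le> ennreal (K * \<epsilon> powr (1 / 3) + XY.rate * \<epsilon> powr (1 / 3))"
    proof (rule holder_norm_half_le)
      show "\<bar>f \<epsilon> x - f0 x\<bar> \<le> K * \<epsilon> powr (1 / 3)" if "x \<in> {a0..b0}" for x
        using Q.potential_sup[OF \<epsilon>(2) that] assms(4)[OF \<epsilon>(1)] assms(6) that
        by (simp add: clamp_eq K_def int0[OF cf] int1[OF cg] int0[OF cont0(1)] int1[OF cont0(2)])
      show "\<bar>(f \<epsilon> x - f0 x) - (f \<epsilon> y - f0 y)\<bar> \<le> XY.rate * \<epsilon> powr (1 / 3) * sqrt \<bar>x - y\<bar>"
        if "x \<in> {a0..b0}" "y \<in> {a0..b0}" for x y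
        using Q.potential_holder[OF \<epsilon>(2) that] that by (simp add: clamp_eq mult_ac)
    qed (use K XY.rate_pos in simp_all)
    then show ?thesis by (simp add: distrib_right)
  qed
  show ?thesis
    using K XY.rate_pos bound by (intro exI[of _ "K + XY.rate"] exI[of _ 1] conjI) auto
qed

end
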